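(* Let $R$ be a finite valuation ring with residue field of odd size $q$ and with uniformizer of nilpotency degree $\ell$. (i) If $R$ is a field (i.e. $\ell=1$), then the set of adjacency eigenvalues of $\mathrm{Pl}(R)$ is $\{q,-1,\pm q^{1/2}\}$, except for $q=3$ in which case $\pm q^{1/2}$ is missing. (ii) If $R$ is not a field (i.e. $\ell\geq 2$), then the set of adjacency eigenvalues of $\mathrm{Pl}(R)$ consists of $q^\ell$, $0$, and $\pm q^{\ell-k/2}$ for $k=1,\dots,\ell$, except for $q=3$ in which case $\pm q^{\ell-1/2}$ is missing.
   Context: Rings are commutative with identity. A finite valuation ring is a finite local principal ring; its maximal ideal is $(\pi)$, $q=|R/(\pi)|$, and $\ell$ is the smallest positive integer with $\pi^\ell=0$. $R^{2,u}$ is the set of pairs $(a,b)\in R^2$ generating $R$ as an ideal. The Platonic graph $\mathrm{Pl}(R)$ has vertex set $R^{2,u}/\{\pm1\}$ (pairs up to sign), and $[a,b]$, $[c,d]$ are adjacent iff $ad-bc=\pm1$. *)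

theory Defs
  imports Complex_Main
begin

section \<open>Finite valuation rings\<close>

text \<open>
  The ring \<open>R\<close> is a type of class \<^class>\<open>comm_ring_1\<close>. Its ideals are the submodules of \<open>R\<close>
  regarded as a module over itself.
\<close>

abbreviation ring_ideal :: "'a::comm_ring_1 set \<Rightarrow> bool"
  where "ring_ideal \<equiv> module.subspace (*)"

abbreviation ideal_gen :: "'a::comm_ring_1 set \<Rightarrow> 'a set"
  where "ideal_gen \<equiv> module.span (*)"

definition maximal_ideal :: "'a::comm_ring_1 set \<Rightarrow> bool"
  where "maximal_ideal M \<longleftrightarrow>
    ring_ideal M \<and> M \<noteq> UNIV \<and> (\<forall>J. ring_ideal J \<longrightarrow> M \<subseteq> J \<longrightarrow> J = M \<or> J = UNIV)"

definition local_ring :: "'a::comm_ring_1 itself \<Rightarrow> bool"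
  where "local_ring _ \<longleftrightarrow> (\<exists>!M :: 'a set. maximal_ideal M)"

definition principal_ring :: "'a::comm_ring_1 itself \<Rightarrow> bool"
  where "principal_ring _ \<longleftrightarrow> (\<forall>I :: 'a set. ring_ideal I \<longrightarrow> (\<exists>a. I = ideal_gen {a}))"

definition finite_valuation_ring :: "'a::comm_ring_1 itself \<Rightarrow> bool"
  where "finite_valuation_ring R \<longleftrightarrow> finite (UNIV :: 'a set) \<and> local_ring R \<and> principal_ring R"

definition field_ring :: "'a::comm_ring_1 itself \<Rightarrow> bool"
  where "field_ring _ \<longleftrightarrow> (\<forall>x :: 'a. x \<noteq> 0 \<longrightarrow> (\<exists>y. x * y = 1))"

definition uniformizer :: "'a::comm_ring_1 \<Rightarrow> bool"
  where "uniformizer p \<longleftrightarrow> maximal_ideal (ideal_gen {p})"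

definition quotient_ring :: "'a::comm_ring_1 set \<Rightarrow> 'a set set"
  where "quotient_ring I = UNIV // {(x, y). x - y \<in> I}"

definition residue_size :: "'a::comm_ring_1 \<Rightarrow> nat"
  where "residue_size p = card (quotient_ring (ideal_gen {p}))"

definition nilpotency_degree :: "'a::comm_ring_1 \<Rightarrow> nat"
  where "nilpotency_degree p = (LEAST n. 0 < n \<and> p ^ n = 0)"


section \<open>The Platonic graph\<close>

definition unimodular_pairs :: "('a::comm_ring_1 \<times> 'a) set"
  where "unimodular_pairs = {(a, b). ideal_gen {a, b} = UNIV}"

definition sign_rel :: "(('a::comm_ring_1 \<times> 'a) \<times> ('a \<times> 'a)) set"
  where "sign_rel = {((a, b), (c, d)). (c, d) = (a, b) \<or> (c, d) = (- a, - b)}"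

definition platonic_vertices :: "('a::comm_ring_1 \<times> 'a) set set"
  where "platonic_vertices = unimodular_pairs // sign_rel"

definition platonic_adj :: "('a::comm_ring_1 \<times> 'a) set \<Rightarrow> ('a \<times> 'a) set \<Rightarrow> bool"
  where "platonic_adj X Y \<longleftrightarrow>
    (\<exists>(a, b) \<in> X. \<exists>(c, d) \<in> Y. a * d - b * c = 1 \<or> a * d - b * c = - 1)"


section \<open>Adjacency eigenvalues of a finite graph\<close>

definition adjacency_operator ::
    "'v set \<Rightarrow> ('v \<Rightarrow> 'v \<Rightarrow> bool) \<Rightarrow> ('v \<Rightarrow> complex) \<Rightarrow> 'v \<Rightarrow> complex"
  where "adjacency_operator V E f v = (\<Sum>w \<in> {w \<in> V. E v w}. f w)"

text \<open>
  Functions are only considered on \<open>V\<close>: an eigenvector must be nonzero somewhere on \<open>V\<close>, and its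
  values outside \<open>V\<close> play no role.
\<close>

definition adjacency_eigenvalues :: "'v set \<Rightarrow> ('v \<Rightarrow> 'v \<Rightarrow> bool) \<Rightarrow> complex set"
  where "adjacency_eigenvalues V E =
    {\<mu>. \<exists>f. (\<exists>v \<in> V. f v \<noteq> 0) \<and> (\<forall>v \<in> V. adjacency_operator V E f v = \<mu> * f v)}"


section \<open>Basic facts\<close>

lemma module_times: "module ((*) :: 'a::comm_ring_1 \<Rightarrow> 'a \<Rightarrow> 'a)"
  by standard (simp_all add: algebra_simps)

lemma ideal_gen_singleton: "ideal_gen {a :: 'a::comm_ring_1} = range (\<lambda>r. r * a)"
  by (rule module.span_singleton[OF module_times])

lemma ring_ideal_gen: "ring_ideal (ideal_gen (S :: 'a::comm_ring_1 set))"
  by (rule module.subspace_span[OF module_times])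

lemma ring_ideal_UNIV_iff:
  assumes "ring_ideal (I :: 'a::comm_ring_1 set)"
  shows "I = UNIV \<longleftrightarrow> 1 \<in> I"
proof
  assume "1 \<in> I"
  then have "c * 1 \<in> I" for c
    using module.subspace_scale[OF module_times assms] by blast
  then show "I = UNIV" by auto
qed auto

lemma ex_maximal_ideal:
  assumes "finite (UNIV :: 'a::comm_ring_1 set)" "ring_ideal (I :: 'a set)" "I \<noteq> UNIV"
  shows "\<exists>M. maximal_ideal M \<and> I \<subseteq> M"
proof -
  let ?A = "{J :: 'a set. ring_ideal J \<and> J \<noteq> UNIV}"
  have "finite ?A"
    using finite_subset[OF _ finite_Pow_iff[THEN iffD2, OF assms(1)], of ?A] by blast
  moreover have "I \<in> ?A" using assms by simp
  ultimately obtain M where "M \<in> ?A" "I \<subseteq> M" "\<forall>J \<in> ?A. M \<subseteq> J \<longrightarrow> M = J"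
    using finite_has_maximal2[of ?A I] by blast
  then show ?thesis unfolding maximal_ideal_def by blast
qed

lemma uniformizer_nilpotent:
  assumes fvr: "finite_valuation_ring TYPE('a::comm_ring_1)" and p: "uniformizer (p :: 'a)"
  shows "\<exists>n. 0 < n \<and> p ^ n = 0"
proof -
  have fin: "finite (UNIV :: 'a set)" and loc: "local_ring TYPE('a)"
    using fvr by (auto simp: finite_valuation_ring_def)
  have "\<not> inj (\<lambda>n :: nat. p ^ n)"
    using fin finite_imageD[of "\<lambda>n. p ^ n" UNIV] finite_subset[OF subset_UNIV] infinite_UNIV_nat
    by blast
  then obtain m n where mn: "m < n" "p ^ m = p ^ n"
    unfolding inj_def by (metis linorder_neqE_nat)
  define k where "k = n - m"
  have k: "0 < k" "n = m + k" using mn by (auto simp: k_def)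
  have "ideal_gen {1 - p ^ k} = UNIV"
  proof (rule ccontr)
    assume "ideal_gen {1 - p ^ k} \<noteq> UNIV"
    then obtain M where M: "maximal_ideal M" "ideal_gen {1 - p ^ k} \<subseteq> M"
      using ex_maximal_ideal[OF fin ring_ideal_gen] by blast
    have eq: "M = ideal_gen {p}"
      using loc M(1) p unfolding local_ring_def uniformizer_def by blast
    have id: "ring_ideal M" using M(1) by (simp add: maximal_ideal_def)
    have "1 - p ^ k \<in> M"
      using M(2) module.span_base[OF module_times] by blast
    moreover have "p ^ k \<in> M"
      using k(1) unfolding eq ideal_gen_singleton
      by (metis power_minus_mult rangeI)
    ultimately have "1 - p ^ k + p ^ k \<in> M"
      using module.subspace_add[OF module_times id] by blast
    then have "M = UNIV" using ring_ideal_UNIV_iff[OF id] by simp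
    then show False using M(1) by (simp add: maximal_ideal_def)
  qed
  then obtain r where r: "r * (1 - p ^ k) = 1"
    unfolding ideal_gen_singleton by (metis UNIV_I imageE)
  have "p ^ m = p ^ m * (r * (1 - p ^ k))" using r by simp
  also have "\<dots> = r * (p ^ m - p ^ n)" by (simp add: k(2) power_add algebra_simps)
  finally have "p ^ m = 0" using mn by simp
  then have "p ^ Suc m = 0" by simp
  then show ?thesis by blast
qed

lemma nilpotency_degree:
  assumes "finite_valuation_ring TYPE('a::comm_ring_1)" "uniformizer (p :: 'a)"
  shows "0 < nilpotency_degree p" "p ^ nilpotency_degree p = 0"
  using LeastI_ex[OF uniformizer_nilpotent[OF assms]] by (simp_all add: nilpotency_degree_def)

lemma field_ring_iff:
  assumes "finite_valuation_ring TYPE('a::comm_ring_1)" "uniformizer (p :: 'a)"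
  shows "field_ring TYPE('a) \<longleftrightarrow> nilpotency_degree p = 1"
proof
  assume F: "field_ring TYPE('a)"
  have "1 \<notin> ideal_gen {p}"
    using assms(2) ring_ideal_UNIV_iff[OF ring_ideal_gen, of "{p}"]
    by (simp add: uniformizer_def maximal_ideal_def)
  then have "\<nexists>y. p * y = 1"
    unfolding ideal_gen_singleton by (metis mult.commute rangeI)
  then have "p = 0" using F by (auto simp: field_ring_def)
  then show "nilpotency_degree p = 1"
    unfolding nilpotency_degree_def by (intro Least_equality) auto
next
  assume "nilpotency_degree p = 1"
  then have p0: "p = 0" using nilpotency_degree(2)[OF assms] by simp
  then have max0: "maximal_ideal {0 :: 'a}"
    using assms(2) by (simp add: uniformizer_def ideal_gen_singleton image_constant_conv)
  show "field_ring TYPE('a)"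
    unfolding field_ring_def
  proof (intro allI impI)
    fix x :: 'a assume x: "x \<noteq> 0"
    have "x \<in> ideal_gen {x}"
      using module.span_base[OF module_times] by blast
    moreover have "{0} \<subseteq> ideal_gen {x}"
      using module.span_zero[OF module_times] by auto
    ultimately have "ideal_gen {x} = UNIV"
      using max0 x ring_ideal_gen[of "{x}"] unfolding maximal_ideal_def by blast
    then show "\<exists>y. x * y = 1"
      unfolding ideal_gen_singleton by (metis UNIV_I imageE mult.commute)
  qed
qed

corollary not_field_ring_iff:
  assumes "finite_valuation_ring TYPE('a::comm_ring_1)" "uniformizer (p :: 'a)"
  shows "\<not> field_ring TYPE('a) \<longleftrightarrow> nilpotency_degree p \<ge> 2"
  using field_ring_iff[OF assms] nilpotency_degree(1)[OF assms] by linarith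

lemma equiv_sign_rel: "equiv UNIV sign_rel"
  by (rule equivI) (auto simp: sign_rel_def refl_on_def sym_def trans_def)

lemma platonic_adj_class:
  "platonic_adj (sign_rel `` {(a, b)}) (sign_rel `` {(c, d)}) \<longleftrightarrow>
    a * d - b * c = 1 \<or> a * d - b * c = - 1"
proof -
  have cls: "sign_rel `` {(x, y)} = {(x, y), (- x, - y)}" for x y :: 'a
    by (auto simp: sign_rel_def)
  have neg: "- x + y = 1 \<longleftrightarrow> x - y = - 1" "- x + y = - 1 \<longleftrightarrow> x - y = 1" for x y :: 'a
    by (metis add.inverse_inverse minus_diff_eq uminus_add_conv_diff)+
  have "a * - d - b * - c = - (a * d) + b * c" "- a * d - - b * c = - (a * d) + b * c"
    "- a * - d - - b * - c = a * d - b * c"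
    by simp_all
  then show ?thesis
    unfolding platonic_adj_def cls
    by (simp only: bex_simps prod.case neg simp_thms disj_ac)
qed

end

theory Submission
  imports Defs "HOL-Library.Product_Plus"
begin

text \<open>
  Functions on the vertices are even functions on \<open>R\<^sup>2\<close> vanishing off the unimodular pairs, and the
  adjacency operator becomes \<open>T f v = \<Sum> f w\<close> over all \<open>w\<close> with \<open>det (v, w) = 1\<close>. Averaging over
  \<open>(\<pi>\<^sup>k R)\<^sup>2\<close> commutes with \<open>T\<close>, so an eigenfunction may be assumed to live at a level \<open>k\<close>: it is
  invariant under \<open>(\<pi>\<^sup>k R)\<^sup>2\<close> while its averages over \<open>(\<pi>\<^sup>j R)\<^sup>2\<close> vanish for \<open>j < k\<close>. For
  \<open>k \<ge> 1\<close> one finds \<open>T\<^sup>2 = q\<^sup>2\<^sup>l\<^sup>-\<^sup>k - q\<^sup>l\<^sup>-\<^sup>1 S\<close> there, where \<open>S\<close> sums over the dilations by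
  \<open>1 + \<pi>\<^sup>k\<^sup>-\<^sup>1 R\<close> and is a multiple of a projection; its two eigenvalues determine \<open>\<mu>\<^sup>2\<close>. Conversely, if
  \<open>S g = 0\<close> and \<open>\<mu>\<^sup>2 = q\<^sup>2\<^sup>l\<^sup>-\<^sup>k\<close>, then \<open>T g + \<mu> g\<close> is an eigenfunction for \<open>\<mu>\<close>. For \<open>q = 3\<close>
  and \<open>k = 1\<close> the units are \<open>\<plusminus>1\<close> modulo \<open>\<pi>\<close>, so \<open>S g \<noteq> 0\<close> for every even \<open>g \<noteq> 0\<close>.
\<close>

section \<open>Unimodular pairs\<close>

definition det2 :: "'a::comm_ring_1 \<times> 'a \<Rightarrow> 'a \<times> 'a \<Rightarrow> 'a"
  where "det2 v w = fst v * snd w - snd v * fst w"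

definition smul :: "'a::comm_ring_1 \<Rightarrow> 'a \<times> 'a \<Rightarrow> 'a \<times> 'a"
  where "smul c v = (c * fst v, c * snd v)"

lemma det2_simps:
  "det2 (u + v) w = det2 u w + det2 v w" "det2 w (u + v) = det2 w u + det2 w v"
  "det2 (u - v) w = det2 u w - det2 v w" "det2 w (u - v) = det2 w u - det2 w v"
  "det2 (- v) w = - det2 v w" "det2 v (- w) = - det2 v w"
  "det2 (smul c v) w = c * det2 v w" "det2 v (smul c w) = c * det2 v w"
  "det2 v v = 0"
  by (simp_all add: det2_def smul_def algebra_simps)

lemma det2_swap: "det2 w v = - det2 v w"
  by (simp add: det2_def algebra_simps)

lemma smul_simps:
  "smul c (smul d v) = smul (c * d) v" "smul 1 v = v" "smul 0 v = 0"
  "smul c (v + w) = smul c v + smul c w" "smul (c + d) v = smul c v + smul d v"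
  "smul c (v - w) = smul c v - smul c w" "smul (c - d) v = smul c v - smul d v"
  "smul c (- v) = - smul c v" "smul (- c) v = - smul c v"
  by (simp_all add: smul_def algebra_simps prod_eq_iff)

text \<open>Cramer's rule: \<open>det(v,w) x = det(x,w) v + det(v,x) w\<close> is a polynomial
  identity, so determinant 1 makes \<open>v\<close>, \<open>w\<close> a basis of R^2 with these
  coordinates.\<close>

lemma cramer_expansion:
  assumes "det2 v w = 1"
  shows "smul (det2 x w) v + smul (det2 v x) w = x"
proof -
  have "smul (det2 x w) v + smul (det2 v x) w = smul (det2 v w) x"
    by (simp add: det2_def smul_def prod_eq_iff algebra_simps)
  then show ?thesis
    by (simp add: assms smul_simps)
qed

text \<open>A Bezout relation \<open>k a + r b = 1\<close> is a determinant 1 with second row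
  \<open>(- r, k)\<close>. So unimodular pairs are the first rows of matrices in SL_2(R), and a
  completing vector is always at hand.\<close>

lemma unimodular_pairs_iff:
  "v \<in> unimodular_pairs \<longleftrightarrow> (\<exists>w. det2 v w = 1)"
proof -
  obtain a b where v: "v = (a, b)" by fastforce
  have "ideal_gen {a, b} = UNIV \<longleftrightarrow> 1 \<in> ideal_gen {a, b}"
    by (rule ring_ideal_UNIV_iff[OF ring_ideal_gen])
  also have "\<dots> \<longleftrightarrow> (\<exists>k r. 1 - k * a = r * b)"
    unfolding module.span_insert[OF module_times, of a] ideal_gen_singleton by auto
  also have "\<dots> \<longleftrightarrow> (\<exists>w. det2 v w = 1)"
  proof
    assume "\<exists>k r. 1 - k * a = r * b"
    then obtain k r where "1 - k * a = r * b" by blast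
    then have "det2 v (- r, k) = 1" by (simp add: v det2_def algebra_simps)
    then show "\<exists>w. det2 v w = 1" by blast
  next
    assume "\<exists>w. det2 v w = 1"
    then obtain w where "det2 v w = 1" by blast
    then have "1 - snd w * a = - fst w * b" by (simp add: v det2_def algebra_simps)
    then show "\<exists>k r. 1 - k * a = r * b" by blast
  qed
  finally show ?thesis
    by (simp add: v unimodular_pairs_def)
qed

lemma unimodularI: "det2 v w = 1 \<Longrightarrow> v \<in> unimodular_pairs" "det2 v w = 1 \<Longrightarrow> w \<in> unimodular_pairs"
  unfolding unimodular_pairs_iff by (blast, metis det2_simps(6) det2_swap minus_minus)

lemma uminus_unimodular_iff [simp]: "- v \<in> unimodular_pairs \<longleftrightarrow> v \<in> unimodular_pairs"
  unfolding unimodular_pairs_iff by (metis det2_simps(5,6) minus_minus)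

lemma sign_class: "sign_rel `` {v} = {v, - v}"
  by (cases v) (auto simp: sign_rel_def)

section \<open>Ideals of a finite valuation ring\<close>

locale odd_valuation_ring =
  fixes p :: "'a::comm_ring_1" and q l :: nat
  assumes fvr: "finite_valuation_ring TYPE('a)"
    and uniformizer: "uniformizer p"
    and q_eq: "q = residue_size p"
    and odd_q: "odd q"
    and l_eq: "l = nilpotency_degree p"
begin

definition P :: "nat \<Rightarrow> 'a set"
  where "P j = range (\<lambda>r. p ^ j * r)"

lemma finite_ring [simp]: "finite (A :: 'a set)"
  using fvr finite_subset[OF subset_UNIV] by (auto simp: finite_valuation_ring_def)

lemma finite_ring_pairs [simp]: "finite (A :: ('a \<times> 'a) set)"
  by (rule finite_subset[of _ "UNIV \<times> UNIV"]) (auto intro: finite_cartesian_product simp del: UNIV_Times_UNIV)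

lemma P_0 [simp]: "P 0 = UNIV"
  by (simp add: P_def)

lemma l_pos: "0 < l" and power_l: "p ^ l = 0"
  using nilpotency_degree[OF fvr uniformizer] by (simp_all add: l_eq)

lemma power_nonzero: "j < l \<Longrightarrow> p ^ j \<noteq> 0"
  \<comment> \<open>Minimality concerns positive exponents only; exponent 0 is covered by
    \<open>1 \<noteq> 0\<close>.\<close>
  using not_less_Least[of j "\<lambda>n. 0 < n \<and> p ^ n = 0"] one_neq_zero[where ?'a='a]
  unfolding l_eq nilpotency_degree_def by (cases "j = 0") auto

lemma P_l [simp]: "P l = {0}"
  by (auto simp: P_def power_l)

lemma P_zero [simp]: "0 \<in> P j"
  unfolding P_def by (metis mult_zero_right rangeI)

lemma power_in_P: "p ^ j \<in> P j"
  unfolding P_def by (metis mult_1_right rangeI)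

lemma P_add [intro]: "x \<in> P j \<Longrightarrow> y \<in> P j \<Longrightarrow> x + y \<in> P j"
  unfolding P_def by (auto simp flip: distrib_left)

lemma P_mult [intro]: "x \<in> P j \<Longrightarrow> c * x \<in> P j"
  unfolding P_def by (auto simp: mult.left_commute[of c])

lemma P_mult' [intro]: "x \<in> P j \<Longrightarrow> x * c \<in> P j"
  using P_mult[of x j c] by (simp add: mult.commute)

lemma P_uminus [simp]: "- x \<in> P j \<longleftrightarrow> x \<in> P j"
  using P_mult[of x j "- 1"] P_mult[of "- x" j "- 1"] by auto

lemma P_diff [intro]: "x \<in> P j \<Longrightarrow> y \<in> P j \<Longrightarrow> x - y \<in> P j"
  using P_add[of x j "- y"] by simp

lemma P_add_iff: "y \<in> P j \<Longrightarrow> x + y \<in> P j \<longleftrightarrow> x \<in> P j"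
  using P_add[of x j y] P_diff[of "x + y" j y] by auto

lemma P_antimono: "i \<le> j \<Longrightarrow> P j \<subseteq> P i"
  by (auto simp: P_def le_iff_add power_add mult.assoc)

lemma ideal_gen_uniformizer: "ideal_gen {p} = P (Suc 0)"
  by (simp add: ideal_gen_singleton P_def mult.commute)

lemma one_notin_P1: "1 \<notin> P (Suc 0)"
  using uniformizer ring_ideal_UNIV_iff[OF ring_ideal_gen, of "{p}"]
  unfolding ideal_gen_uniformizer[symmetric] by (simp add: uniformizer_def maximal_ideal_def)

text \<open>A nonunit generates a proper ideal, which lies in a maximal one, and in the local ring
  that can only be \<open>P (Suc 0)\<close>.\<close>

lemma unit_iff: "(\<exists>y. x * y = 1) \<longleftrightarrow> x \<notin> P (Suc 0)"
proof
  assume "\<exists>y. x * y = 1"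
  then show "x \<notin> P (Suc 0)" using one_notin_P1 P_mult' by metis
next
  assume x: "x \<notin> P (Suc 0)"
  have "ideal_gen {x} = UNIV"
  proof (rule ccontr)
    assume "ideal_gen {x} \<noteq> UNIV"
    then obtain M where M: "maximal_ideal M" "ideal_gen {x} \<subseteq> M"
      using ex_maximal_ideal[OF finite_ring ring_ideal_gen] by blast
    have "M = P (Suc 0)"
      using fvr M(1) uniformizer
      unfolding finite_valuation_ring_def local_ring_def uniformizer_def ideal_gen_uniformizer
      by blast
    moreover have "x \<in> ideal_gen {x}"
      using module.span_base[OF module_times] by blast
    ultimately show False using M(2) x by blast
  qed
  then show "\<exists>y. x * y = 1"
    unfolding ideal_gen_singleton by (metis UNIV_I imageE mult.commute)
qed

section \<open>Sizes of the ideals \<open>P j\<close>, and consequences of odd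
  \<open>q\<close>\<close>

text \<open>For a unit \<open>x\<close> each \<open>x - p r\<close> is again a unit, so
  \<open>p ^ j\<close> can annihilate it only if \<open>p ^ j = 0\<close>.\<close>

lemma power_mult_in_P_Suc:
  assumes "j < l" "p ^ j * x \<in> P (Suc j)"
  shows "x \<in> P (Suc 0)"
proof (rule ccontr)
  assume x: "x \<notin> P (Suc 0)"
  obtain r where "p ^ j * x = p ^ Suc j * r" using assms(2) by (auto simp: P_def)
  then have 0: "p ^ j * (x - p * r) = 0" by (simp add: algebra_simps)
  have "p * r \<in> P (Suc 0)" by (simp add: P_def)
  then have "x - p * r \<notin> P (Suc 0)" using x P_add_iff[of "- (p * r)" 1 x] by simp
  then obtain y where "(x - p * r) * y = 1" using unit_iff by blast
  then have "p ^ j = p ^ j * (x - p * r) * y" by (simp add: mult.assoc)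
  then show False using 0 power_nonzero[OF assms(1)] by simp
qed

text \<open>Turns the cardinality of the residue field into a transversal of ring elements, which
  serve as the digits when \<open>P j\<close> is counted.\<close>

lemma ex_residue_representatives:
  obtains Q where "card Q = q" "\<And>x. \<exists>\<rho>\<in>Q. x - \<rho> \<in> P (Suc 0)"
    "\<And>\<rho> \<rho>'. \<rho> \<in> Q \<Longrightarrow> \<rho>' \<in> Q \<Longrightarrow> \<rho> - \<rho>' \<in> P (Suc 0) \<Longrightarrow> \<rho> = \<rho>'"
proof -
  let ?E = "{(x, y). x - y \<in> P (Suc 0)}"
  have E: "equiv UNIV ?E"
  proof (rule equivI)
    show "sym ?E" by (rule symI) (use P_uminus in fastforce)
    show "trans ?E"
    proof (rule transI)
      fix x y z assume "(x, y) \<in> ?E" "(y, z) \<in> ?E"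
      then have "(x - y) + (y - z) \<in> P (Suc 0)" by blast
      then show "(x, z) \<in> ?E" by simp
    qed
  qed (auto simp: refl_on_def)
  define \<sigma> where "\<sigma> X = (SOME x. x \<in> X)" for X :: "'a set"
  have \<sigma>: "\<sigma> X \<in> X" if "X \<in> UNIV // ?E" for X
    unfolding \<sigma>_def using in_quotient_imp_non_empty[OF E that] some_in_eq by blast
  have "inj_on \<sigma> (UNIV // ?E)"
  proof (rule inj_onI)
    fix X Y assume XY: "X \<in> UNIV // ?E" "Y \<in> UNIV // ?E" "\<sigma> X = \<sigma> Y"
    then show "X = Y" using quotient_disj[OF E XY(1,2)] \<sigma> by (metis disjoint_iff)
  qed
  then have "card (\<sigma> ` (UNIV // ?E)) = q"
    by (simp add: card_image q_eq residue_size_def quotient_ring_def ideal_gen_uniformizer)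
  moreover have "\<exists>\<rho>\<in>\<sigma> ` (UNIV // ?E). x - \<rho> \<in> P (Suc 0)" for x
  proof -
    have "\<sigma> (?E `` {x}) \<in> ?E `` {x}" by (rule \<sigma>) (rule quotientI[OF UNIV_I])
    then show ?thesis using quotientI[of x UNIV ?E] by blast
  qed
  moreover have "\<rho> = \<rho>'"
    if im: "\<rho> \<in> \<sigma> ` (UNIV // ?E)" "\<rho>' \<in> \<sigma> ` (UNIV // ?E)" and d: "\<rho> - \<rho>' \<in> P (Suc 0)" for \<rho> \<rho>'
  proof -
    obtain X Y where XY: "X \<in> UNIV // ?E" "\<rho> = \<sigma> X" "Y \<in> UNIV // ?E" "\<rho>' = \<sigma> Y" using im by blast
    have "X = Y"
      using quotient_eqI[OF E XY(1,3)] \<sigma>[OF XY(1)] \<sigma>[OF XY(3)] d XY by blast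
    then show ?thesis using XY by simp
  qed
  ultimately show ?thesis using that by blast
qed

text \<open>Every element of \<open>P j\<close> is uniquely \<open>p ^ j \<rho> + y\<close> with a
  digit \<open>\<rho>\<close> from the transversal and \<open>y\<close> in
  \<open>P (Suc j)\<close>.\<close>

lemma card_P_Suc:
  assumes "j < l"
  shows "card (P j) = q * card (P (Suc j))"
proof -
  obtain Q where Q: "card Q = q" "\<And>x. \<exists>\<rho>\<in>Q. x - \<rho> \<in> P (Suc 0)"
    "\<And>\<rho> \<rho>'. \<rho> \<in> Q \<Longrightarrow> \<rho>' \<in> Q \<Longrightarrow> \<rho> - \<rho>' \<in> P (Suc 0) \<Longrightarrow> \<rho> = \<rho>'"
    by (rule ex_residue_representatives) blast
  let ?h = "\<lambda>(\<rho>, y). p ^ j * \<rho> + y"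
  have "inj_on ?h (Q \<times> P (Suc j))"
  proof (rule inj_onI, clarify)
    fix \<rho> y \<rho>' y'
    assume *: "\<rho> \<in> Q" "\<rho>' \<in> Q" "y \<in> P (Suc j)" "y' \<in> P (Suc j)" "p ^ j * \<rho> + y = p ^ j * \<rho>' + y'"
    then have "p ^ j * (\<rho> - \<rho>') = y' - y" by (simp add: algebra_simps)
    then have "\<rho> - \<rho>' \<in> P (Suc 0)" using power_mult_in_P_Suc[OF assms] * P_diff by metis
    then have "\<rho> = \<rho>'" using *(1,2) Q(3) by blast
    then show "\<rho> = \<rho>' \<and> y = y'" using * by simp
  qed
  moreover have "?h ` (Q \<times> P (Suc j)) = P j"
  proof (intro subset_antisym subsetI)
    fix x assume "x \<in> ?h ` (Q \<times> P (Suc j))"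
    then obtain \<rho> y where "x = p ^ j * \<rho> + y" "y \<in> P (Suc j)" by auto
    moreover have "p ^ j * \<rho> \<in> P j" by (simp add: P_def)
    ultimately show "x \<in> P j" using P_antimono[of j "Suc j"] by auto
  next
    fix x assume "x \<in> P j"
    then obtain z where x: "x = p ^ j * z" by (auto simp: P_def)
    obtain \<rho> where \<rho>: "\<rho> \<in> Q" "z - \<rho> \<in> P (Suc 0)" using Q(2) by blast
    then obtain r where "z - \<rho> = p * r" by (auto simp: P_def)
    then have "x = ?h (\<rho>, p ^ Suc j * r)" by (simp add: x algebra_simps)
    then show "x \<in> ?h ` (Q \<times> P (Suc j))" using \<rho> by (force simp: P_def)
  qed
  ultimately show ?thesis
    using Q(1) by (metis card_cartesian_product card_image)
qed

lemma card_P: "j \<le> l \<Longrightarrow> card (P j) = q ^ (l - j)"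
proof (induction "l - j" arbitrary: j)
  case (Suc n)
  then have "card (P j) = q * q ^ (l - Suc j)" using card_P_Suc[of j] by simp
  also have "\<dots> = q ^ (l - j)" using Suc.hyps(2) by (metis Suc_diff_Suc power_Suc zero_less_Suc zero_less_diff)
  finally show ?case .
qed simp

lemma card_ring: "card (UNIV :: 'a set) = q ^ l"
  using card_P[of 0] by simp

text \<open>Translation by 1 permutes R, so summing all elements gives \<open>q ^ l = 0\<close> in
  R. As \<open>q ^ l\<close> is odd, this reads \<open>2 m + 1 = 0\<close> and exhibits an inverse
  of 2.\<close>

lemma two_notin_P1: "2 \<notin> P (Suc 0)"
proof -
  have "(\<Sum>x\<in>UNIV. x) = (\<Sum>x\<in>UNIV. x + (1 :: 'a))"
    by (rule sum.reindex_bij_witness[of _ "\<lambda>x. x + 1" "\<lambda>x. x - 1"]) auto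
  then have 0: "of_nat (q ^ l) = (0 :: 'a)" by (simp add: sum.distrib card_ring)
  have "odd (q ^ l)" using odd_q by simp
  then obtain m where "q ^ l = 2 * m + 1" by (rule oddE)
  then have "2 * of_nat m + 1 = (0 :: 'a)" using 0 by (metis of_nat_add of_nat_mult of_nat_1 of_nat_numeral)
  then have "2 * (- of_nat m) = (1 :: 'a)" by (metis add_eq_0_iff mult_minus_right minus_minus)
  then show ?thesis using unit_iff by blast
qed

lemma q_ge_3: "q \<ge> 3"
proof -
  have "card (P (Suc 0)) < card (P 0)"
    using one_notin_P1 by (intro psubset_card_mono) auto
  then have "q ^ (l - 1) < q ^ l" using l_pos by (simp add: card_P del: P_0)
  then have "q \<noteq> 1" by auto
  with odd_q show ?thesis by presburger
qed

lemma one_neq_uminus_one: "(1 :: 'a) \<noteq> - 1"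
proof
  assume "(1 :: 'a) = - 1"
  then have "(2 :: 'a) = 0" by (simp add: eq_neg_iff_add_eq_0)
  then show False using two_notin_P1 by simp
qed

lemma not_unimodular_iff: "v \<notin> unimodular_pairs \<longleftrightarrow> fst v \<in> P (Suc 0) \<and> snd v \<in> P (Suc 0)"
proof
  assume v: "v \<notin> unimodular_pairs"
  then have "det2 v (0, y) \<noteq> 1" "det2 v (- y, 0) \<noteq> 1" for y by (auto simp: unimodular_pairs_iff)
  then show "fst v \<in> P (Suc 0) \<and> snd v \<in> P (Suc 0)" unfolding det2_def by (metis add.inverse_inverse diff_0_right diff_minus_eq_add add_0 fst_conv snd_conv mult_minus_right mult_zero_right unit_iff)
next
  assume v: "fst v \<in> P (Suc 0) \<and> snd v \<in> P (Suc 0)"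
  then have "det2 v w \<in> P (Suc 0)" for w unfolding det2_def by blast
  then show "v \<notin> unimodular_pairs" using one_notin_P1 by (metis unimodular_pairs_iff)
qed

text \<open>Here \<open>s = p ^ j e\<close> with a unit \<open>e\<close>, which reindexing absorbs.
  Multiplication by \<open>p ^ j\<close> maps R onto \<open>P j\<close>, and its fibres are
  translates of its kernel.\<close>

lemma sum_mult_element:
  fixes h :: "'a \<Rightarrow> complex"
  assumes j: "j < l" and s: "s \<in> P j" "s \<notin> P (Suc j)"
  shows "(\<Sum>t\<in>UNIV. h (s * t)) = of_nat (q ^ j) * (\<Sum>r\<in>P j. h r)"
proof -
  obtain e where e: "s = p ^ j * e" using s(1) by (auto simp: P_def)
  have "e \<notin> P (Suc 0)" using s(2) by (auto simp: e P_def mult.assoc mult.left_commute[of p] power_commutes)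
  then obtain e' where e': "e * e' = 1" using unit_iff by blast
  define K where "K = card {t. p ^ j * t = 0}"
  have fibre: "card {t. p ^ j * t = r} = K" if r: "r \<in> P j" for r
  proof -
    obtain t0 where t0: "r = p ^ j * t0" using r by (auto simp: P_def)
    have "{t. p ^ j * t = r} = (\<lambda>t. t0 + t) ` {t. p ^ j * t = 0}"
    proof (intro subset_antisym subsetI)
      fix t assume "t \<in> {t. p ^ j * t = r}"
      then have "p ^ j * (t - t0) = 0" by (simp add: t0 algebra_simps)
      then show "t \<in> (\<lambda>t. t0 + t) ` {t. p ^ j * t = 0}" by (intro image_eqI[of _ _ "t - t0"]) auto
    qed (auto simp: t0 algebra_simps)
    then show ?thesis by (simp add: card_image K_def)
  qed
  have sum_fibre: "(\<Sum>t\<in>UNIV. h' (p ^ j * t)) = of_nat K * (\<Sum>r\<in>P j. h' r)" for h' :: "'a \<Rightarrow> complex"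
  proof -
    have "(\<Sum>t\<in>UNIV. h' (p ^ j * t)) = (\<Sum>r\<in>P j. \<Sum>t\<in>{t \<in> UNIV. p ^ j * t = r}. h' (p ^ j * t))"
      by (rule sum.group[symmetric]) (auto simp: P_def)
    also have "\<dots> = (\<Sum>r\<in>P j. of_nat K * h' r)"
      by (rule sum.cong) (simp_all add: fibre)
    finally show ?thesis by (simp add: sum_distrib_left)
  qed
  \<comment> \<open>The constant function 1 reveals the kernel size \<open>K\<close>.\<close>
  have "complex_of_nat (q ^ l) = of_nat K * of_nat (q ^ (l - j))"
    using sum_fibre[of "\<lambda>_. 1"] j by (simp add: card_P card_ring)
  moreover have "complex_of_nat (q ^ l) = of_nat (q ^ j) * of_nat (q ^ (l - j))"
    using j by (simp flip: power_add of_nat_mult)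
  ultimately have K: "complex_of_nat K = of_nat (q ^ j)" using q_ge_3 by simp
  have "(\<Sum>t\<in>UNIV. h (s * t)) = (\<Sum>t\<in>UNIV. h (p ^ j * t))"
    by (rule sum.reindex_bij_witness[of _ "\<lambda>t. e' * t" "\<lambda>t. e * t"])
      (use e' in \<open>simp_all add: e mult.assoc[symmetric] mult.commute[of e' e]\<close>)
  then show ?thesis using sum_fibre K by simp
qed

section \<open>The adjacency operator on even functions\<close>

definition T :: "('a \<times> 'a \<Rightarrow> complex) \<Rightarrow> 'a \<times> 'a \<Rightarrow> complex"
  where "T f v = (\<Sum>w | det2 v w = 1. f w)"

text \<open>Left unnormalised, so that compositions produce factors
  \<open>card (P k) ^ 2\<close>.\<close>

definition B :: "nat \<Rightarrow> ('a \<times> 'a \<Rightarrow> complex) \<Rightarrow> 'a \<times> 'a \<Rightarrow> complex"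
  where "B k f v = (\<Sum>y\<in>P k \<times> P k. f (v + y))"

text \<open>For \<open>k = 0\<close> the sum includes nonunits \<open>c\<close>; they contribute
  nothing when \<open>f\<close> vanishes off the unimodular pairs.\<close>

definition S :: "nat \<Rightarrow> ('a \<times> 'a \<Rightarrow> complex) \<Rightarrow> 'a \<times> 'a \<Rightarrow> complex"
  where "S k f v = (\<Sum>c | c - 1 \<in> P k. f (smul c v))"

definition admissible :: "('a \<times> 'a \<Rightarrow> complex) \<Rightarrow> bool"
  where "admissible f \<longleftrightarrow> (\<forall>v. f (- v) = f v) \<and> (\<forall>v. v \<notin> unimodular_pairs \<longrightarrow> f v = 0)"

lemma admissible_even: "admissible f \<Longrightarrow> f (- v) = f v"
  and admissible_zero: "admissible f \<Longrightarrow> v \<notin> unimodular_pairs \<Longrightarrow> f v = 0"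
  unfolding admissible_def by blast+

lemma T_not_unimodular: "v \<notin> unimodular_pairs \<Longrightarrow> T f v = 0"
  unfolding T_def using unimodularI(1)[of v] by (intro sum.neutral) blast

text \<open>The solutions \<open>u\<close> of \<open>det2 v u = 1\<close> form the affine line
  \<open>w + R v\<close>.\<close>

lemma T_eq:
  assumes "det2 v w = 1"
  shows "T f v = (\<Sum>t\<in>UNIV. f (w + smul t v))"
  unfolding T_def
proof (rule sum.reindex_bij_witness[of _ "\<lambda>t. w + smul t v" "\<lambda>u. det2 u w"])
  fix u assume "u \<in> {u. det2 v u = 1}"
  then show "w + smul (det2 u w) v = u"
    using cramer_expansion[OF assms, of u] by (simp add: smul_simps add.commute)
  then show "f (w + smul (det2 u w) v) = f u" by simp
qed (simp_all add: det2_simps assms)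

lemma T_T_eq:
  assumes "\<And>v. f (- v) = f v" and vw: "det2 v w = 1"
  shows "T (T f) v = (\<Sum>s\<in>UNIV. \<Sum>t\<in>UNIV. f (v + smul s (w + smul t v)))"
proof -
  have "T f (w + smul t v) = (\<Sum>s\<in>UNIV. f (v + smul s (w + smul t v)))" for t
  proof -
    \<comment> \<open>\<open>- v\<close> serves as base point of the line of solutions belonging to
      \<open>w + t v\<close>; evenness and the substitution of \<open>- s\<close> for
      \<open>s\<close> then turn it into \<open>v\<close>.\<close>
    have "det2 (w + smul t v) (- v) = 1"
      using vw det2_swap[of w v] by (simp add: det2_simps)
    then have "T f (w + smul t v) = (\<Sum>s\<in>UNIV. f (- v + smul s (w + smul t v)))"
      by (rule T_eq)
    also have "\<dots> = (\<Sum>s\<in>UNIV. f (v + smul s (w + smul t v)))"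
    proof (rule sum.reindex_bij_witness[of _ uminus uminus])
      fix s
      show "f (v + smul (- s) (w + smul t v)) = f (- v + smul s (w + smul t v))"
        using assms(1)[of "- v + smul s (w + smul t v)"] by (simp add: smul_simps algebra_simps)
    qed simp_all
    finally show ?thesis .
  qed
  then have "T (T f) v = (\<Sum>t\<in>UNIV. \<Sum>s\<in>UNIV. f (v + smul s (w + smul t v)))"
    by (simp add: T_eq[OF vw])
  also have "\<dots> = (\<Sum>s\<in>UNIV. \<Sum>t\<in>UNIV. f (v + smul s (w + smul t v)))"
    by (rule sum.swap)
  finally show ?thesis .
qed

lemma det2_in_P:
  assumes "y \<in> P j \<times> P j"
  shows "det2 v y \<in> P j" "det2 y v \<in> P j"
  using assms unfolding det2_def by (auto intro!: P_diff intro: P_mult P_mult')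

text \<open>The change to coordinates in the basis \<open>v\<close>, \<open>w\<close> and its
  inverse have coefficients in R, so both preserve \<open>P j \<times> P j\<close>.\<close>

lemma sum_P_basis:
  assumes "det2 v w = 1"
  shows "(\<Sum>y\<in>P j \<times> P j. F y) = (\<Sum>r\<in>P j. \<Sum>s\<in>P j. F (smul r v + smul s w))"
  unfolding sum.cartesian_product
proof (rule sum.reindex_bij_witness[of _ "\<lambda>(r, s). smul r v + smul s w" "\<lambda>y. (det2 y w, det2 v y)"])
  fix y assume "y \<in> P j \<times> P j"
  then show "(det2 y w, det2 v y) \<in> P j \<times> P j" by (simp add: det2_in_P)
qed (auto simp: cramer_expansion[OF assms] det2_simps assms mem_Times_iff, auto simp: smul_def)

text \<open>In a basis \<open>v\<close>, \<open>w\<close> the map \<open>det2 v\<close> reads off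
  the \<open>w\<close> coordinate and leaves the \<open>v\<close> coordinate free in
  \<open>P k\<close>. The count is the same for all unimodular \<open>v\<close>, which makes
  averaging commute with \<open>T\<close>.\<close>

lemma card_det2_eq:
  assumes "v \<in> unimodular_pairs"
  shows "card {y \<in> P k \<times> P k. det2 v y = c} = (if c \<in> P k then card (P k) else 0)"
proof (cases "c \<in> P k")
  case True
  obtain w where vw: "det2 v w = 1" using assms unimodular_pairs_iff by blast
  have "bij_betw (\<lambda>r. smul r v + smul c w) (P k) {y \<in> P k \<times> P k. det2 v y = c}"
  proof (rule bij_betw_byWitness[where f' = "\<lambda>y. det2 y w"])
    show "\<forall>y\<in>{y \<in> P k \<times> P k. det2 v y = c}. smul (det2 y w) v + smul c w = y"
      using cramer_expansion[OF vw] by auto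
  qed (use True in \<open>auto simp: det2_simps vw det2_in_P mem_Times_iff\<close>, auto simp: smul_def)
  then show ?thesis using True bij_betw_same_card by fastforce
next
  case False
  have "det2 v y \<in> P k" if "y \<in> P k \<times> P k" for y using that by (rule det2_in_P)
  then have "{y \<in> P k \<times> P k. det2 v y = c} = {}" using False by auto
  then show ?thesis using False by simp
qed

section \<open>Averaging operators\<close>

text \<open>After exchanging sums, \<open>f u\<close> is weighted by the number of \<open>y\<close>
  with \<open>det2 v (u - y) = 1\<close> on one side and \<open>det2 (v + y) u = 1\<close> on the
  other. The conditions prescribe the value \<open>det2 v u - 1\<close> for \<open>det2 v y\<close>
  and \<open>det2 u y\<close> respectively, so \<open>card_det2_eq\<close> gives equal
  counts.\<close>

lemma T_B_commute:
  assumes f: "\<And>u. u \<notin> unimodular_pairs \<Longrightarrow> f u = 0" and v: "v \<in> unimodular_pairs"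
  shows "T (B k f) v = B k (T f) v"
proof -
  have T_if: "T g x = (\<Sum>u\<in>UNIV. if det2 x u = 1 then g u else 0)" for g x
    unfolding T_def by (simp add: sum.If_cases)
  have card_if: "(\<Sum>y\<in>P k \<times> P k. if Q y then f u else 0) = of_nat (card {y \<in> P k \<times> P k. Q y}) * f u" for Q u
    by (simp add: sum.If_cases Collect_conj_eq)
  have "T (B k f) v = (\<Sum>w\<in>UNIV. \<Sum>y\<in>P k \<times> P k. if det2 v w = 1 then f (w + y) else 0)"
    unfolding T_if B_def by (rule sum.cong) auto
  also have "\<dots> = (\<Sum>y\<in>P k \<times> P k. \<Sum>w\<in>UNIV. if det2 v w = 1 then f (w + y) else 0)"
    by (rule sum.swap)
  also have "\<dots> = (\<Sum>y\<in>P k \<times> P k. \<Sum>u\<in>UNIV. if det2 v (u - y) = 1 then f u else 0)"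
    by (intro sum.cong refl sum.reindex_bij_witness[of _ "\<lambda>u. u - y" "\<lambda>w. w + y" for y]) auto
  also have "\<dots> = (\<Sum>u\<in>UNIV. \<Sum>y\<in>P k \<times> P k. if det2 v (u - y) = 1 then f u else 0)"
    by (rule sum.swap)
  also have "\<dots> = (\<Sum>u\<in>UNIV. \<Sum>y\<in>P k \<times> P k. if det2 (v + y) u = 1 then f u else 0)"
  proof (rule sum.cong[OF refl])
    fix u
    show "(\<Sum>y\<in>P k \<times> P k. if det2 v (u - y) = 1 then f u else 0) =
      (\<Sum>y\<in>P k \<times> P k. if det2 (v + y) u = 1 then f u else 0)"
    proof (cases "u \<in> unimodular_pairs")
      case True
      have eq: "det2 v (u - y) = 1 \<longleftrightarrow> det2 v y = det2 v u - 1"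
        "det2 (v + y) u = 1 \<longleftrightarrow> det2 u y = det2 v u - 1" for y
        using det2_swap[of y u] by (auto simp: det2_simps algebra_simps)
      show ?thesis
        unfolding card_if eq card_det2_eq[OF v] card_det2_eq[OF True] ..
    qed (simp add: card_if f)
  qed
  also have "\<dots> = (\<Sum>y\<in>P k \<times> P k. \<Sum>u\<in>UNIV. if det2 (v + y) u = 1 then f u else 0)"
    by (rule sum.swap)
  also have "\<dots> = B k (T f) v"
    unfolding T_if B_def ..
  finally show ?thesis .
qed

lemma B_shift:
  assumes "fst z \<in> P j" "snd z \<in> P j"
  shows "B j f (v + z) = B j f v"
  unfolding B_def
  by (rule sum.reindex_bij_witness[of _ "\<lambda>y. y - z" "\<lambda>y. z + y"])
    (use assms in \<open>auto simp: add.assoc mem_Times_iff\<close>)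

text \<open>The outer sum absorbs the inner shifts. In particular, where \<open>B j f\<close>
  vanishes, so does \<open>B j\<close> of \<open>B k f\<close>.\<close>

lemma B_B:
  assumes "j \<le> k"
  shows "B j (B k f) v = of_nat (card (P k)) ^ 2 * B j f v"
proof -
  have "B j (B k f) v = (\<Sum>z\<in>P k \<times> P k. B j f (v + z))"
    unfolding B_def by (subst sum.swap) (simp add: ac_simps)
  also have "\<dots> = (\<Sum>z\<in>P k \<times> P k. B j f v)"
    using P_antimono[OF assms] by (intro sum.cong refl B_shift) auto
  finally show ?thesis by (simp add: card_cartesian_product power2_eq_square)
qed

lemma unimodular_shift:
  assumes "fst z \<in> P (Suc 0)" "snd z \<in> P (Suc 0)"
  shows "v + z \<in> unimodular_pairs \<longleftrightarrow> v \<in> unimodular_pairs"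
  using not_unimodular_iff[of v] not_unimodular_iff[of "v + z"] P_add_iff assms by auto

lemma unimodular_smul_iff:
  "smul c v \<in> unimodular_pairs \<longleftrightarrow> c \<notin> P (Suc 0) \<and> v \<in> unimodular_pairs"
proof -
  have "c * x \<in> P (Suc 0) \<longleftrightarrow> x \<in> P (Suc 0)" if "c \<notin> P (Suc 0)" for x
  proof
    obtain d where "c * d = 1" using \<open>c \<notin> P (Suc 0)\<close> unit_iff by blast
    then have "x = d * (c * x)" by (metis mult.assoc mult.commute mult_1)
    moreover assume "c * x \<in> P (Suc 0)"
    ultimately show "x \<in> P (Suc 0)" by (metis P_mult)
  qed blast
  moreover have "c * x \<in> P (Suc 0)" if "c \<in> P (Suc 0)" for x using that by blast
  ultimately show ?thesis
    using not_unimodular_iff[of v] not_unimodular_iff[of "smul c v"] by (auto simp: smul_def)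
qed

text \<open>Shifts from \<open>P k\<close> with \<open>k > 0\<close> preserve unimodularity, whereas
  \<open>B 0 f\<close> is constant on all of R^2.\<close>

lemma admissible_B:
  assumes "admissible f" "0 < k"
  shows "admissible (B k f)"
  unfolding admissible_def
proof (intro conjI allI impI)
  fix v
  show "B k f (- v) = B k f v"
    unfolding B_def
  proof (rule sum.reindex_bij_witness[of _ uminus uminus])
    fix y :: "'a \<times> 'a"
    show "f (v + - y) = f (- v + y)"
      using admissible_even[OF assms(1)] by (metis minus_add_distrib minus_minus)
  qed (auto simp: mem_Times_iff)
next
  fix v :: "'a \<times> 'a" assume v: "v \<notin> unimodular_pairs"
  have "f (v + y) = 0" if "y \<in> P k \<times> P k" for y
  proof -
    have "v + y \<notin> unimodular_pairs"
      using that v unimodular_shift[of y v] P_antimono[of "Suc 0" k] assms(2)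
      by (auto simp: mem_Times_iff)
    then show ?thesis using admissible_zero[OF assms(1)] by blast
  qed
  then show "B k f v = 0" by (simp add: B_def)
qed

text \<open>Splitting the sum over \<open>s\<close> in \<open>T_T_eq\<close> by the valuation of \<open>s\<close> makes it telescope.\<close>

lemma T_T_level:
  assumes k: "0 < k" "k \<le> l" and g: "admissible g"
    and inv: "\<And>v z. fst z \<in> P k \<Longrightarrow> snd z \<in> P k \<Longrightarrow> g (v + z) = g v"
    and B0: "\<And>j v. j < k \<Longrightarrow> B j g v = 0"
    and v: "v \<in> unimodular_pairs"
  shows "T (T g) v = of_nat q ^ (2 * l - k) * g v - of_nat q ^ (l - 1) * S (k - 1) g v"
proof -
  obtain w where vw: "det2 v w = 1" using v unimodular_pairs_iff by blast
  \<comment> \<open>\<open>D 0\<close> is the double sum of \<open>T_T_eq\<close>, and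
    \<open>D j\<close> keeps the terms with \<open>s\<close> in \<open>P j\<close>.
    \<open>C j\<close> is the excess that arises when a sum over \<open>P j - P (Suc j)\<close> is
    completed to one over \<open>P j\<close>.\<close>
  define D where "D j = (\<Sum>s\<in>P j. \<Sum>t\<in>UNIV. g (v + smul s (w + smul t v)))" for j
  define C where "C j = (\<Sum>s\<in>P (Suc j). \<Sum>r\<in>P j. g (v + smul r v + smul s w))" for j
  have B_eq: "B j g x = (\<Sum>r\<in>P j. \<Sum>s\<in>P j. g (x + (smul r v + smul s w)))" for j x
    unfolding B_def by (rule sum_P_basis[OF vw])
  \<comment> \<open>For \<open>s\<close> of valuation exactly \<open>j\<close> the products
    \<open>s t\<close> run through \<open>P j\<close>, each value \<open>q ^ j\<close> times.
    Completing the sum over \<open>s\<close> gives \<open>B j g v = 0\<close> minus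
    \<open>C j\<close>.\<close>
  have step: "D j = D (Suc j) - of_nat q ^ j * C j" if j: "j < k" for j
  proof -
    have sub: "P (Suc j) \<subseteq> P j" by (rule P_antimono) simp
    have "D j = D (Suc j) + (\<Sum>s\<in>P j - P (Suc j). \<Sum>t\<in>UNIV. g (v + smul s (w + smul t v)))"
      unfolding D_def by (subst sum.subset_diff[OF sub]) simp_all
    also have "(\<Sum>s\<in>P j - P (Suc j). \<Sum>t\<in>UNIV. g (v + smul s (w + smul t v))) =
      (\<Sum>s\<in>P j - P (Suc j). of_nat q ^ j * (\<Sum>r\<in>P j. g (v + smul r v + smul s w)))"
    proof (rule sum.cong[OF refl])
      fix s assume "s \<in> P j - P (Suc j)"
      then have "(\<Sum>t\<in>UNIV. g (v + smul (s * t) v + smul s w)) =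
        of_nat (q ^ j) * (\<Sum>r\<in>P j. g (v + smul r v + smul s w))"
        using j k by (intro sum_mult_element) auto
      then show "(\<Sum>t\<in>UNIV. g (v + smul s (w + smul t v))) =
        of_nat q ^ j * (\<Sum>r\<in>P j. g (v + smul r v + smul s w))"
        by (simp add: smul_simps ac_simps)
    qed
    also have "\<dots> = of_nat q ^ j * ((\<Sum>s\<in>P j. \<Sum>r\<in>P j. g (v + smul r v + smul s w)) - C j)"
      unfolding C_def sum_distrib_left[symmetric]
      by (subst sum.subset_diff[OF sub, of "\<lambda>s. \<Sum>r\<in>P j. g (v + smul r v + smul s w)"]) simp_all
    also have "(\<Sum>s\<in>P j. \<Sum>r\<in>P j. g (v + smul r v + smul s w)) = B j g v"
      unfolding B_eq by (subst sum.swap) (simp add: add.assoc)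
    finally show ?thesis using B0[OF j] by simp
  qed
  \<comment> \<open>Shifting \<open>r\<close> by \<open>r'\<close> in \<open>P (Suc j)\<close> does
    not change the sum. Summing over \<open>r'\<close> as well turns a multiple of
    \<open>C j\<close> into a sum of values of \<open>B (Suc j) g\<close>, which vanish.\<close>
  have C_0: "C j = 0" if j: "Suc j < k" for j
  proof -
    have "of_nat (card (P (Suc j))) * C j =
      (\<Sum>r'\<in>P (Suc j). \<Sum>s\<in>P (Suc j). \<Sum>r\<in>P j. g (v + smul r v + smul s w))"
      by (simp add: C_def)
    also have "\<dots> = (\<Sum>r'\<in>P (Suc j). \<Sum>s\<in>P (Suc j). \<Sum>r\<in>P j.
      g (v + smul r v + (smul r' v + smul s w)))"
    proof (rule sum.cong[OF refl], rule sum.cong[OF refl])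
      fix r' s assume r': "r' \<in> P (Suc j)"
      then have r'j: "r' \<in> P j" using P_antimono[of j "Suc j"] by auto
      show "(\<Sum>r\<in>P j. g (v + smul r v + smul s w)) =
        (\<Sum>r\<in>P j. g (v + smul r v + (smul r' v + smul s w)))"
        by (rule sum.reindex_bij_witness[of _ "\<lambda>r. r + r'" "\<lambda>r. r - r'"])
          (use r'j in \<open>auto simp: smul_simps ac_simps\<close>)
    qed
    also have "\<dots> = (\<Sum>r'\<in>P (Suc j). \<Sum>r\<in>P j. \<Sum>s\<in>P (Suc j). 
      g (v + smul r v + (smul r' v + smul s w)))"
      by (rule sum.cong[OF refl], rule sum.swap)
    also have "\<dots> = (\<Sum>r\<in>P j. B (Suc j) g (v + smul r v))"
      unfolding B_eq by (rule sum.swap)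
    also have "\<dots> = 0" using B0[OF j] by simp
    finally show ?thesis using card_P[of "Suc j"] j k q_ge_3 by simp
  qed
  \<comment> \<open>In the one surviving term invariance removes \<open>s\<close> in
    \<open>P k\<close>, and \<open>v + r v\<close> is the dilation of \<open>v\<close> by
    \<open>1 + r\<close>.\<close>
  have C_last: "C (k - 1) = of_nat q ^ (l - k) * S (k - 1) g v"
  proof -
    have "C (k - 1) = (\<Sum>s\<in>P k. \<Sum>r\<in>P (k - 1). g (v + smul r v))"
      unfolding C_def using k by (intro sum.cong inv) (auto simp: smul_def)
    also have "(\<Sum>r\<in>P (k - 1). g (v + smul r v)) = S (k - 1) g v"
      unfolding S_def
      by (rule sum.reindex_bij_witness[of _ "\<lambda>c. c - 1" "\<lambda>r. 1 + r"]) (auto simp: smul_simps)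
    finally show ?thesis using k by (simp add: card_P)
  qed
  have "D k = (\<Sum>s\<in>P k. \<Sum>t\<in>(UNIV :: 'a set). g v)"
    unfolding D_def by (intro sum.cong refl inv) (auto simp: smul_def)
  also have "\<dots> = of_nat q ^ (2 * l - k) * g v"
    using k by (simp add: card_P card_ring mult_2 flip: power_add)
  finally have D_k: "D k = of_nat q ^ (2 * l - k) * g v" .
  have "D (k - 1) = D (k - 1 - i)" if "i \<le> k - 1" for i
    using that
  proof (induction i)
    case (Suc i)
    then have "D (k - 1 - Suc i) = D (Suc (k - 1 - Suc i))"
      using step[of "k - 1 - Suc i"] C_0[of "k - 1 - Suc i"] by simp
    then show ?case using Suc by (simp add: Suc_diff_Suc)
  qed simp
  from this[of "k - 1"] have "D 0 = D (k - 1)" by simp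
  also have "\<dots> = D k - of_nat q ^ (k - 1) * (of_nat q ^ (l - k) * S (k - 1) g v)"
    using step[of "k - 1"] k C_last by simp
  also have "\<dots> = of_nat q ^ (2 * l - k) * g v - of_nat q ^ (l - 1) * S (k - 1) g v"
    using k by (simp add: D_k mult.assoc[symmetric] flip: power_add)
  finally show ?thesis
    using T_T_eq[of g, OF admissible_even[OF g] vw] by (simp add: D_def)
qed

section \<open>Sums over dilations\<close>

text \<open>The set \<open>1 + P j\<close> is closed under multiplication and contains the inverse
  \<open>c'\<close> of its unit \<open>c\<close>, because \<open>c' - 1 = - c' (c - 1)\<close>.
  Hence multiplication by \<open>c\<close> permutes it.\<close>

lemma sum_one_plus_P_mult:
  assumes c: "c - 1 \<in> P j" "c \<notin> P (Suc 0)"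
  shows "(\<Sum>d | d - 1 \<in> P j. F (d * c)) = (\<Sum>d | d - 1 \<in> P j. F d)"
proof -
  obtain c' where c': "c * c' = 1" using c unit_iff by blast
  have "c' - 1 = - c' * (c - 1)" using c' by (simp add: algebra_simps)
  then have c'1: "c' - 1 \<in> P j" using c(1) by (metis P_mult)
  have "d * e - 1 \<in> P j" if "d - 1 \<in> P j" "e - 1 \<in> P j" for d e
  proof -
    have "d * e - 1 = d * (e - 1) + (d - 1)" by (simp add: algebra_simps)
    then show ?thesis using that by (metis P_add P_mult)
  qed
  then show ?thesis
    by (intro sum.reindex_bij_witness[of _ "\<lambda>d. d * c'" "\<lambda>d. d * c"])
      (use c c' c'1 in \<open>auto simp: mult.assoc mult.commute[of c' c]\<close>)
qed

text \<open>A unit \<open>c\<close> in the outer sum only permutes the inner one, and a nonunit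
  gives 0.\<close>

lemma S_S:
  assumes "\<And>u. u \<notin> unimodular_pairs \<Longrightarrow> g u = 0"
  shows "S j (S j g) v = of_nat (card {c. c - 1 \<in> P j \<and> c \<notin> P (Suc 0)}) * S j g v"
proof -
  have "S j (S j g) v = (\<Sum>c | c - 1 \<in> P j. \<Sum>d | d - 1 \<in> P j. g (smul (d * c) v))"
    by (simp add: S_def smul_simps)
  also have "\<dots> = (\<Sum>c | c - 1 \<in> P j. if c \<notin> P (Suc 0) then S j g v else 0)"
  proof (rule sum.cong[OF refl])
    fix c assume "c \<in> {c. c - 1 \<in> P j}"
    moreover have "g (smul (d * c) v) = 0" if "c \<in> P (Suc 0)" for d
      using that unimodular_smul_iff assms P_mult by metis
    ultimately show "(\<Sum>d | d - 1 \<in> P j. g (smul (d * c) v)) = (if c \<notin> P (Suc 0) then S j g v else 0)"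
      using sum_one_plus_P_mult[of c j "\<lambda>d. g (smul d v)"] by (auto simp: S_def)
  qed
  also have "\<dots> = of_nat (card {c. c - 1 \<in> P j \<and> c \<notin> P (Suc 0)}) * S j g v"
    by (simp add: sum.If_cases Int_def)
  finally show ?thesis .
qed

lemma one_plus_P_unit: "c - 1 \<in> P j \<Longrightarrow> 0 < j \<Longrightarrow> c \<notin> P (Suc 0)"
  using P_antimono[of "Suc 0" j] P_diff[of c "Suc 0" "c - 1"] one_notin_P1 by auto

lemma card_translate_P: "card {c. c - a \<in> P j} = card (P j)"
  by (rule bij_betw_same_card[of "\<lambda>c. c - a"], rule bij_betw_byWitness[where f' = "\<lambda>r. r + a"]) auto

lemma card_units_one_plus_P:
  assumes "j < l"
  shows "card {c. c - 1 \<in> P j \<and> c \<notin> P (Suc 0)} = (if j = 0 then q ^ l - q ^ (l - 1) else q ^ (l - j))"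
proof (cases "j = 0")
  case True
  have "card (- P (Suc 0)) = q ^ l - q ^ (l - 1)"
    using card_P[of "Suc 0"] l_pos by (simp add: Compl_eq_Diff_UNIV card_Diff_subset card_ring)
  then show ?thesis using True by (simp add: Compl_eq)
next
  case False
  then have "{c. c - 1 \<in> P j \<and> c \<notin> P (Suc 0)} = {c. c - 1 \<in> P j}"
    using one_plus_P_unit by blast
  then show ?thesis using False assms by (simp add: card_translate_P card_P)
qed

text \<open>Nonunits \<open>c\<close> drop out since they destroy unimodularity; for units,
  rescaling \<open>t\<close> absorbs the factor on \<open>v\<close>. Thus \<open>f\<close> is summed
  over the strip of points whose \<open>w\<close> coordinate is a unit in
  \<open>1 + P j\<close>.\<close>

lemma T_S:
  assumes f: "\<And>u. u \<notin> unimodular_pairs \<Longrightarrow> f u = 0" and vw: "det2 v w = 1"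
  shows "T (S j f) v = (\<Sum>c | c - 1 \<in> P j \<and> c \<notin> P (Suc 0). \<Sum>t\<in>UNIV. f (smul c w + smul t v))"
proof -
  have "T (S j f) v = (\<Sum>c | c - 1 \<in> P j. \<Sum>t\<in>UNIV. f (smul c (w + smul t v)))"
    unfolding T_eq[OF vw] S_def by (rule sum.swap)
  also have "\<dots> = (\<Sum>c | c - 1 \<in> P j \<and> c \<notin> P (Suc 0). \<Sum>t\<in>UNIV. f (smul c (w + smul t v)))"
    by (rule sum.mono_neutral_right) (auto intro!: sum.neutral f simp: unimodular_smul_iff)
  also have "\<dots> = (\<Sum>c | c - 1 \<in> P j \<and> c \<notin> P (Suc 0). \<Sum>t\<in>UNIV. f (smul c w + smul t v))"
  proof (rule sum.cong[OF refl])
    fix c assume "c \<in> {c. c - 1 \<in> P j \<and> c \<notin> P (Suc 0)}"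
    then obtain c' where c': "c * c' = 1" using unit_iff by blast
    show "(\<Sum>t\<in>UNIV. f (smul c (w + smul t v))) = (\<Sum>t\<in>UNIV. f (smul c w + smul t v))"
      by (rule sum.reindex_bij_witness[of _ "\<lambda>t. c' * t" "\<lambda>t. c * t"])
        (use c' in \<open>simp_all add: smul_simps mult.assoc[symmetric] mult.commute[of c' c]\<close>)
  qed
  finally show ?thesis .
qed

text \<open>In coordinates \<open>c w + t v\<close> the vanishing total sum splits into the row
  \<open>c = 0\<close>, which is \<open>S 0 f v\<close>, and the remaining rows, which by
  \<open>T_S\<close> make up \<open>T (S 0 f) v\<close>.\<close>

lemma T_S_field:
  assumes "l = 1" and f: "\<And>u. u \<notin> unimodular_pairs \<Longrightarrow> f u = 0" and "(\<Sum>u\<in>UNIV. f u) = 0"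
    and v: "v \<in> unimodular_pairs"
  shows "T (S 0 f) v = - S 0 f v"
proof -
  obtain w where vw: "det2 v w = 1" using v unimodular_pairs_iff by blast
  have P1: "P (Suc 0) = {0}" using P_l assms(1) by simp
  have "0 = (\<Sum>c\<in>UNIV. \<Sum>t\<in>UNIV. f (smul c w + smul t v))"
    using sum_P_basis[OF vw, of f 0] assms(3) 
    by (subst sum.swap) (simp add: add.commute)
  also have "\<dots> = (\<Sum>t\<in>UNIV. f (smul t v)) + (\<Sum>c\<in>UNIV - {0}. \<Sum>t\<in>UNIV. f (smul c w + smul t v))"
    by (subst sum.remove[of _ 0]) (simp_all add: smul_simps)
  also have "\<dots> = S 0 f v + T (S 0 f) v"
    by (simp add: T_S[OF f vw] S_def P1 set_diff_eq)
  finally show ?thesis by (simp add: eq_neg_iff_add_eq_0 add.commute)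
qed

text \<open>The classes of 0, 1 and -1 modulo \<open>p\<close> are disjoint because 1 and 2 are
  units. They hold \<open>3 q ^ (l - 1)\<close> of the \<open>q ^ l\<close> elements.\<close>

lemma residue_size_eq_3_iff:
  "q = 3 \<longleftrightarrow> (\<forall>c. c \<in> P (Suc 0) \<or> c - 1 \<in> P (Suc 0) \<or> c + 1 \<in> P (Suc 0))"
proof -
  let ?A = "\<lambda>a. {c. c - a \<in> P (Suc 0)}"
  have card_A: "card (?A a) = q ^ (l - 1)" for a
    using card_P[of "Suc 0"] l_pos by (simp add: card_translate_P)
  have disj: "?A a \<inter> ?A b = {}" if "b - a \<notin> P (Suc 0)" for a b
  proof -
    have "b - a \<in> P (Suc 0)" if "c - a \<in> P (Suc 0)" "c - b \<in> P (Suc 0)" for c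
      using P_diff[OF that] by simp
    then show ?thesis using that by blast
  qed
  have "?A 0 \<inter> ?A 1 = {}" "(?A 0 \<union> ?A 1) \<inter> ?A (- 1) = {}"
    using disj[of 1 0] disj[of "-1" 0] disj[of "-1" 1] one_notin_P1 two_notin_P1 P_uminus[of 2]
    by (auto simp del: P_uminus)
  then have "card (?A 0 \<union> ?A 1 \<union> ?A (- 1)) = card (?A 0) + card (?A 1) + card (?A (- 1))"
    by (metis card_Un_disjoint finite_ring)
  then have "card (?A 0 \<union> ?A 1 \<union> ?A (- 1)) = 3 * q ^ (l - 1)"
    unfolding card_A by simp
  moreover have "card (UNIV :: 'a set) = q * q ^ (l - 1)"
    using l_pos by (simp add: card_ring flip: power_Suc)
  ultimately have "q = 3 \<longleftrightarrow> card (?A 0 \<union> ?A 1 \<union> ?A (- 1)) = card (UNIV :: 'a set)"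
    using q_ge_3 by auto
  also have "\<dots> \<longleftrightarrow> ?A 0 \<union> ?A 1 \<union> ?A (- 1) = UNIV"
    using card_subset_eq[OF finite_ring subset_UNIV] by metis
  also have "\<dots> \<longleftrightarrow> (\<forall>c. c \<in> P (Suc 0) \<or> c - 1 \<in> P (Suc 0) \<or> c + 1 \<in> P (Suc 0))"
    by (auto simp: set_eq_iff)
  finally show ?thesis .
qed

section \<open>Eigenvalues\<close>

text \<open>Each neighbouring class \<open>{w, - w}\<close> has exactly one member of determinant 1:
  a sign change turns -1 into 1, and \<open>1 \<noteq> - 1\<close> excludes a second one.\<close>

lemma adjacency_operator_platonic:
  fixes v :: "'a \<times> 'a"
  assumes "v \<in> unimodular_pairs"
  shows "adjacency_operator platonic_vertices platonic_adj F (sign_rel `` {v}) =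
    T (\<lambda>w. F (sign_rel `` {w})) v"
proof -
  let ?cls = "\<lambda>w :: 'a \<times> 'a. sign_rel `` {w}"
  have adj: "platonic_adj (?cls v) (?cls w) \<longleftrightarrow> det2 v w = 1 \<or> det2 v w = - 1" for w
    using platonic_adj_class[of "fst v" "snd v" "fst w" "snd w"] by (simp add: det2_def)
  have "inj_on ?cls {w. det2 v w = 1}"
  proof (rule inj_onI)
    fix w w' assume *: "w \<in> {w. det2 v w = 1}" "w' \<in> {w. det2 v w = 1}" "?cls w = ?cls w'"
    then have "w = w' \<or> w = - w'" unfolding sign_class by blast
    then show "w = w'" using * one_neq_uminus_one by (auto simp: det2_simps)
  qed
  moreover have "{X \<in> platonic_vertices. platonic_adj (?cls v) X} = ?cls ` {w. det2 v w = 1}"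
  proof (intro subset_antisym subsetI)
    fix X assume "X \<in> {X \<in> platonic_vertices. platonic_adj (?cls v) X}"
    then obtain w where w: "X = ?cls w" "det2 v w = 1 \<or> det2 v w = - 1"
      unfolding platonic_vertices_def by (auto elim!: quotientE simp: adj)
    moreover have "?cls (- w) = ?cls w" unfolding sign_class by auto
    moreover have "det2 v (- w) = 1" if "det2 v w = - 1" using that by (simp add: det2_simps)
    ultimately show "X \<in> ?cls ` {w. det2 v w = 1}" by (metis (mono_tags) imageI mem_Collect_eq)
  next
    fix X assume "X \<in> ?cls ` {w. det2 v w = 1}"
    then obtain w where "X = ?cls w" "det2 v w = 1" by blast
    then show "X \<in> {X \<in> platonic_vertices. platonic_adj (?cls v) X}"
      using quotientI[OF unimodularI(2)[of v w], of sign_rel] adj[of w]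
      by (simp add: platonic_vertices_def)
  qed
  ultimately show ?thesis
    unfolding adjacency_operator_def T_def by (simp add: sum.reindex)
qed

text \<open>Functions on sign classes are even functions. Extending them by 0 is harmless, since
  \<open>T\<close> evaluates only at unimodular pairs and vanishes off them.\<close>

lemma platonic_eigenvalue_iff:
  "\<mu> \<in> adjacency_eigenvalues (platonic_vertices :: ('a \<times> 'a) set set) platonic_adj \<longleftrightarrow>
    (\<exists>f. admissible f \<and> (\<exists>v. f v \<noteq> 0) \<and> (\<forall>v. T f v = \<mu> * f v))"
  (is "?L \<longleftrightarrow> ?R")
proof
  let ?cls = "\<lambda>w :: 'a \<times> 'a. sign_rel `` {w}"
  assume ?L
  then obtain F and X :: "('a \<times> 'a) set" where F: "X \<in> platonic_vertices" "F X \<noteq> 0"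
    "\<And>X. X \<in> platonic_vertices \<Longrightarrow> adjacency_operator platonic_vertices platonic_adj F X = \<mu> * F X"
    unfolding adjacency_eigenvalues_def by blast
  define f where "f v = (if v \<in> unimodular_pairs then F (?cls v) else 0)" for v
  have "?cls (- v) = ?cls v" for v unfolding sign_class by auto
  then have "admissible f" by (simp add: admissible_def f_def del: split_paired_All)
  moreover obtain v where "v \<in> unimodular_pairs" "X = ?cls v"
    using F(1) unfolding platonic_vertices_def by (rule quotientE)
  then have "f v \<noteq> 0" using F(2) by (simp add: f_def)
  moreover have "T f v = \<mu> * f v" for v
  proof (cases "v \<in> unimodular_pairs")
    case True
    have "T f v = T (\<lambda>w. F (?cls w)) v"
      unfolding T_def f_def by (intro sum.cong) (auto dest: unimodularI(2))
    also have "\<dots> = \<mu> * F (?cls v)"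
      using True F(3)[of "?cls v"] adjacency_operator_platonic[OF True]
      by (simp add: platonic_vertices_def quotientI)
    finally show ?thesis using True by (simp add: f_def)
  qed (simp add: T_not_unimodular f_def)
  ultimately show ?R by blast
next
  let ?cls = "\<lambda>w :: 'a \<times> 'a. sign_rel `` {w}"
  assume ?R
  then obtain f v where f: "admissible f" "f v \<noteq> 0" "\<And>v. T f v = \<mu> * f v" by blast
  define F where "F X = f (SOME w. w \<in> X)" for X
  have F: "F (?cls w) = f w" for w
  proof -
    have "(SOME x. x \<in> {w, - w}) \<in> {w, - w}" by (rule someI[of _ w]) simp
    then show ?thesis using admissible_even[OF f(1), of w] unfolding F_def sign_class by auto
  qed
  have v: "v \<in> unimodular_pairs" using f(2) admissible_zero[OF f(1)] by blast
  have "adjacency_operator platonic_vertices platonic_adj F X = \<mu> * F X"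
    if "X \<in> platonic_vertices" for X
  proof -
    obtain u where "u \<in> unimodular_pairs" "X = ?cls u"
      using \<open>X \<in> platonic_vertices\<close> unfolding platonic_vertices_def by (rule quotientE)
    then show ?thesis by (simp add: adjacency_operator_platonic F f(3))
  qed
  moreover have "?cls v \<in> platonic_vertices" using v by (simp add: platonic_vertices_def quotientI)
  moreover have "F (?cls v) \<noteq> 0" using f(2) by (simp add: F)
  ultimately show ?L unfolding adjacency_eigenvalues_def by blast
qed

lemma T_cmult: "T (\<lambda>u. a * f u) v = a * T f v"
  by (simp add: T_def sum_distrib_left)

lemma S_cmult: "S j (\<lambda>u. a * f u) v = a * S j f v"
  by (simp add: S_def sum_distrib_left)

lemma B_cmult: "B j (\<lambda>u. a * f u) v = a * B j f v"
  by (simp add: B_def sum_distrib_left)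

section \<open>Restricting the possible eigenvalues\<close>

text \<open>The cases follow the level \<open>k\<close> and \<open>g = B k f\<close>. Level 0 gives
  a constant function and \<open>q ^ l\<close>. Otherwise, at a point \<open>v\<close> with
  \<open>g v \<noteq> 0\<close>, vanishing of \<open>S (k - 1) g v\<close> gives the second case; if
  it is nonzero, \<open>k \<ge> 2\<close> gives 0 and \<open>k = 1\<close> the last case.\<close>

lemma eigenvalue_cases:
  assumes adm: "admissible f" and nz: "f v0 \<noteq> 0" and eig: "\<And>v. T f v = \<mu> * f v"
  obtains "\<mu> = of_nat q ^ l"
  | k where "1 \<le> k" "k \<le> l" "\<not> (q = 3 \<and> k = 1)" "\<mu>\<^sup>2 = of_nat q ^ (2 * l - k)"
  | "2 \<le> l" "\<mu> = 0"
  | "\<mu>\<^sup>2 = of_nat q ^ (2 * l - 2)" "l = 1 \<Longrightarrow> \<mu> = - 1"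
proof -
  have f0: "f u = 0" if "u \<notin> unimodular_pairs" for u
    using that by (rule admissible_zero[OF adm])
  define k where "k = (LEAST k. \<exists>v. B k f v \<noteq> 0)"
  \<comment> \<open>As \<open>P l\<close> is zero, a level exists and is at most
    \<open>l\<close>.\<close>
  have "B l f v = f v" for v by (simp add: B_def zero_prod_def[symmetric])
  then have ex: "\<exists>v. B l f v \<noteq> 0" using nz by metis
  then have "\<exists>v. B k f v \<noteq> 0" unfolding k_def by (rule LeastI)
  then obtain v where v: "B k f v \<noteq> 0" by blast
  have kl: "k \<le> l" using ex unfolding k_def by (rule Least_le)
  have B0: "B j f u = 0" if "j < k" for j u
    using not_less_Least[of j "\<lambda>k. \<exists>v. B k f v \<noteq> 0"] that unfolding k_def by blast
  have T_fun: "T f = (\<lambda>v. \<mu> * f v)" using eig by blast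
  have TB: "T (B k f) u = \<mu> * B k f u" if "u \<in> unimodular_pairs" for u
    by (simp add: T_B_commute[OF f0 that] T_fun B_cmult)
  show thesis
  proof (cases "k = 0")
    case True
    have v0: "v0 \<in> unimodular_pairs" using nz f0 by blast
    then obtain w0 where w0: "det2 v0 w0 = 1" using unimodular_pairs_iff by blast
    have const: "B 0 f u = B 0 f v" for u
      using B_shift[of "u - v" 0 f v] by simp
    have "\<mu> * B 0 f v = T (B 0 f) v0" using TB[OF v0] const[of v0] True by simp
    also have "\<dots> = (\<Sum>t\<in>(UNIV :: 'a set). B 0 f v)"
      unfolding T_eq[OF w0] by (intro sum.cong refl const)
    also have "\<dots> = of_nat q ^ l * B 0 f v" by (simp add: card_ring)
    finally have "\<mu> * B 0 f v = of_nat q ^ l * B 0 f v" .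
    then have "\<mu> = of_nat q ^ l" using v True by simp
    then show thesis by (rule that(1))
  next
    case False
    define g where "g = B k f"
    have g: "admissible g" unfolding g_def using False by (intro admissible_B adm) simp
    then have g0: "g u = 0" if "u \<notin> unimodular_pairs" for u
      using that by (rule admissible_zero)
    have v_uni: "v \<in> unimodular_pairs" using v g0 g_def by blast
    have inv: "g (u + z) = g u" if "fst z \<in> P k" "snd z \<in> P k" for u z
      unfolding g_def by (rule B_shift[OF that])
    have Bg: "B j g u = 0" if "j < k" for j u
      using that by (simp add: g_def B_B B0)
    have Tg: "T g u = \<mu> * g u" for u
      using TB[of u] g0[of u] T_not_unimodular[of u g] by (cases "u \<in> unimodular_pairs") (auto simp: g_def)
    then have Tg_fun: "T g = (\<lambda>u. \<mu> * g u)" by blast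
    have TTg: "\<mu>\<^sup>2 * g u = of_nat q ^ (2 * l - k) * g u - of_nat q ^ (l - 1) * S (k - 1) g u"
      if "u \<in> unimodular_pairs" for u
      using T_T_level[OF _ kl g inv Bg that] False
      by (simp add: Tg_fun T_cmult power2_eq_square mult.assoc)
    define n :: complex where "n = of_nat (card {c. c - 1 \<in> P (k - 1) \<and> c \<notin> P (Suc 0)})"
    have SSg: "S (k - 1) (S (k - 1) g) u = n * S (k - 1) g u" for u
      unfolding n_def by (rule S_S) (rule g0)
    have k_card: "card {c. c - 1 \<in> P (k - 1) \<and> c \<notin> P (Suc 0)} =
      (if k = 1 then q ^ l - q ^ (l - 1) else q ^ (l - k + 1))"
    proof -
      have "l - (k - 1) = l - k + 1" using False kl by simp
      then show ?thesis using card_units_one_plus_P[of "k - 1"] False kl by simp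
    qed
    have gv: "g v \<noteq> 0" using v by (simp add: g_def)
    show thesis
    proof (cases "S (k - 1) g v = 0")
      case True
      have "\<not> (q = 3 \<and> k = 1)"
      proof
        assume q3: "q = 3 \<and> k = 1"
        \<comment> \<open>Every unit is 1 or -1 modulo \<open>p\<close>, so invariance and evenness
          make each unit multiple of \<open>v\<close> contribute \<open>g v\<close>.\<close>
        have "S 0 g v = (\<Sum>c\<in>UNIV. if c \<notin> P (Suc 0) then g v else 0)"
          unfolding S_def
        proof (rule sum.cong)
          fix c :: 'a
          show "g (smul c v) = (if c \<notin> P (Suc 0) then g v else 0)"
          proof (cases "c \<in> P (Suc 0)")
            case True
            then show ?thesis using g0[of "smul c v"] unimodular_smul_iff by simp
          next
            case False
            then consider "c - 1 \<in> P (Suc 0)" | "c + 1 \<in> P (Suc 0)"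
              using residue_size_eq_3_iff q3 by blast
            then have "g (smul c v) = g v"
            proof cases
              case 1
              have "g (v + smul (c - 1) v) = g v"
                using 1 q3 by (intro inv) (auto simp: smul_def)
              then show ?thesis by (simp add: smul_simps)
            next
              case 2
              have "g (- v + smul (c + 1) v) = g (- v)"
                using 2 q3 by (intro inv) (auto simp: smul_def)
              then show ?thesis using admissible_even[OF g] by (simp add: smul_simps)
            qed
            then show ?thesis using False by simp
          qed
        qed simp
        also have "\<dots> = n * g v"
          using q3 by (simp add: n_def sum.If_cases Compl_eq)
        finally have "n * g v = 0" using True q3 by simp
        moreover have "n \<noteq> 0"
          using q3 l_pos unfolding n_def k_card by (cases l) auto
        ultimately show False using gv by simp
      qed
      moreover have "\<mu>\<^sup>2 = of_nat q ^ (2 * l - k)"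
        using TTg[OF v_uni] True gv by simp
      ultimately show thesis using that(2)[of k] False kl by simp
    next
      case S_nz: False
      \<comment> \<open>The identity is extended to all points before \<open>S (k - 1)\<close> is
        applied, which for \<open>k = 1\<close> also evaluates at nonunimodular ones.\<close>
      have TTg': "\<mu>\<^sup>2 * g u = of_nat q ^ (2 * l - k) * g u - of_nat q ^ (l - 1) * S (k - 1) g u" for u
      proof (cases "u \<in> unimodular_pairs")
        case False
        have "S (k - 1) g u = 0"
          unfolding S_def using False by (intro sum.neutral ballI g0) (simp add: unimodular_smul_iff)
        then show ?thesis using False by (simp add: g0)
      qed (rule TTg)
      have "S (k - 1) (\<lambda>u. \<mu>\<^sup>2 * g u) v =
        of_nat q ^ (2 * l - k) * S (k - 1) g v - of_nat q ^ (l - 1) * S (k - 1) (S (k - 1) g) v"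
        unfolding TTg' unfolding S_def by (simp add: sum_subtractf sum_distrib_left)
      then have "\<mu>\<^sup>2 * S (k - 1) g v = (of_nat q ^ (2 * l - k) - of_nat q ^ (l - 1) * n) * S (k - 1) g v"
        unfolding S_cmult SSg by (simp add: algebra_simps)
      then have \<mu>2: "\<mu>\<^sup>2 = of_nat q ^ (2 * l - k) - of_nat q ^ (l - 1) * n" using S_nz by simp
      show thesis
      proof (cases "k = 1")
        case k1: True
        \<comment> \<open>Now \<open>n\<close> counts the units, and
          \<open>q ^ (2 l - 1) - q ^ (l - 1) n\<close> collapses to
          \<open>q ^ (2 l - 2)\<close>.\<close>
        have "of_nat (q ^ l - q ^ (l - 1)) = (of_nat q ^ l - of_nat q ^ (l - 1) :: complex)"
          using q_ge_3 by (subst of_nat_diff) (auto intro: power_increasing)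
        then have n: "n = of_nat q ^ l - of_nat q ^ (l - 1)"
          unfolding n_def k_card using k1 by simp
        have e: "2 * l - 1 = (l - 1) + l" "2 * l - 2 = (l - 1) + (l - 1)" using l_pos by auto
        have sq: "\<mu>\<^sup>2 = of_nat q ^ (2 * l - 2)"
          unfolding \<mu>2 n k1 e power_add by (simp add: algebra_simps)
        \<comment> \<open>Over a field the square is 1 and the sign is open. The identity yields
          \<open>S 0 g = (q - 1) g\<close>, and \<open>T_S_field\<close> shows that \<open>T\<close>
          acts on it as -1.\<close>
        have "\<mu> = - 1" if l1: "l = 1"
        proof -
          have "S 0 g u = (of_nat q - 1) * g u" for u
            using TTg'[of u] sq by (simp add: l1 k1 algebra_simps)
          then have S_fun: "S 0 g = (\<lambda>u. (of_nat q - 1) * g u)" by blast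
          have "(\<Sum>u\<in>UNIV. g u) = B 0 g 0" by (simp add: B_def)
          also have "\<dots> = 0" using Bg k1 by simp
          finally have "T (S 0 g) v = - S 0 g v"
            using T_S_field[OF l1 g0 _ v_uni] by simp
          then have "(of_nat q - 1) * \<mu> * g v = - (of_nat q - 1) * g v"
            unfolding S_fun T_cmult Tg by (simp add: algebra_simps)
          moreover have "of_nat q - 1 \<noteq> (0 :: complex)" using q_ge_3 by auto
          ultimately show ?thesis using gv
            by (metis mult_cancel_left mult_cancel_right mult_minus1_right)
        qed
        with sq show thesis by (rule that(4))
      next
        case kn1: False
        \<comment> \<open>For \<open>k \<ge> 2\<close> the two terms of the square cancel
          exactly.\<close>
        have "2 * l - k = (l - 1) + (l - k + 1)" using kl False kn1 by auto
        then have e: "of_nat q ^ (2 * l - k) = (of_nat q ^ (l - 1) * of_nat q ^ (l - k + 1) :: complex)"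
          by (simp only: power_add)
        have "n = of_nat q ^ (l - k + 1)" unfolding n_def k_card using kn1 by simp
        then have "\<mu>\<^sup>2 = 0" unfolding \<mu>2 e by simp
        then show thesis using that(3) kl kn1 False by simp
      qed
    qed
  qed
qed

section \<open>Constructing eigenfunctions\<close>

lemma T_uminus: "T f (- v) = T (\<lambda>w. f (- w)) v"
  unfolding T_def by (rule sum.reindex_bij_witness[of _ uminus uminus]) (auto simp: det2_simps)

lemma T_admissible: "admissible f \<Longrightarrow> admissible (T f)"
  unfolding admissible_def using T_uminus[of f] T_not_unimodular[of _ f] by presburger

lemma degree_eigenvalue:
  "of_nat q ^ l \<in> adjacency_eigenvalues (platonic_vertices :: ('a \<times> 'a) set set) platonic_adj"
proof -
  define f :: "'a \<times> 'a \<Rightarrow> complex" where "f v = (if v \<in> unimodular_pairs then 1 else 0)" for v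
  have "T f v = of_nat q ^ l * f v" for v
  proof (cases "v \<in> unimodular_pairs")
    case True
    then obtain w where vw: "det2 v w = 1" using unimodular_pairs_iff by blast
    then have "det2 v (w + smul t v) = 1" for t by (simp add: det2_simps)
    then have "w + smul t v \<in> unimodular_pairs" for t using unimodularI(2) by blast
    then show ?thesis using True by (simp add: T_eq[OF vw] f_def card_ring)
  qed (simp add: f_def T_not_unimodular)
  moreover have "admissible f" by (simp add: admissible_def f_def del: split_paired_All)
  moreover have "det2 (1 :: 'a, 0) (0, 1) = 1" by (simp add: det2_def)
  then have "f (1, 0) \<noteq> 0" unfolding f_def by (auto dest: unimodularI(1))
  ultimately show ?thesis unfolding platonic_eigenvalue_iff by blast
qed

text \<open>Dilation by such \<open>c\<close> permutes \<open>1 + P (k - 1)\<close> but moves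
  \<open>(1, 0)\<close> modulo \<open>P k\<close> away from itself and its negative. For
  \<open>k = 1\<close> this needs a residue class other than 0, 1, -1; for \<open>k \<ge> 2\<close>
  one takes \<open>1 + p ^ (k - 1)\<close>, where \<open>c + 1\<close> is 2 modulo
  \<open>p\<close>.\<close>

lemma ex_level_multiplier:
  assumes k: "1 \<le> k" "k \<le> l" "\<not> (q = 3 \<and> k = 1)"
  obtains c where "c - 1 \<in> P (k - 1)" "c \<notin> P (Suc 0)" "c - 1 \<notin> P k" "c + 1 \<notin> P k"
proof (cases "k = 1")
  case True
  then show thesis using that k(3) residue_size_eq_3_iff by auto
next
  case False
  define c where "c = 1 + p ^ (k - 1)"
  have c1: "c - 1 \<in> P (k - 1)" by (simp add: c_def power_in_P)
  have "c + 1 \<notin> P k"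
  proof
    assume "c + 1 \<in> P k"
    moreover have "P k \<subseteq> P (Suc 0)" "P (k - 1) \<subseteq> P (Suc 0)"
      using k False by (auto intro!: P_antimono)
    ultimately have "(c + 1) - (c - 1) \<in> P (Suc 0)" using c1 by blast
    then show False using two_notin_P1 by simp
  qed
  moreover have "c - 1 \<notin> P k"
    using power_mult_in_P_Suc[of "k - 1" 1] one_notin_P1 k(1,2) diff_less[of 1 k] by (simp add: c_def) force
  moreover have "c \<notin> P (Suc 0)" using one_plus_P_unit[OF c1] k False by simp
  ultimately show thesis using that c1 by blast
qed

text \<open>The function \<open>h\<close> is the indicator of the vectors congruent to
  \<open>(1, 0)\<close> or its negative modulo \<open>P k\<close>. Subtracting its dilate by
  \<open>c\<close> kills both \<open>S (k - 1)\<close> and all \<open>B j\<close> with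
  \<open>j < k\<close>, so \<open>T_T_level\<close> leaves
  \<open>T (T g) = \<mu>\<^sup>2 g\<close>.\<close>

lemma level_eigenvalue:
  assumes k: "1 \<le> k" "k \<le> l" "\<not> (q = 3 \<and> k = 1)" and \<mu>: "\<mu>\<^sup>2 = of_nat q ^ (2 * l - k)"
  shows "\<mu> \<in> adjacency_eigenvalues (platonic_vertices :: ('a \<times> 'a) set set) platonic_adj"
proof -
  obtain c where c: "c - 1 \<in> P (k - 1)" "c \<notin> P (Suc 0)" "c - 1 \<notin> P k" "c + 1 \<notin> P k"
    using ex_level_multiplier[OF k] by blast
  obtain c' where c': "c * c' = 1" using c(2) unit_iff by blast
  have Pk: "P k \<subseteq> P (Suc 0)" using k by (intro P_antimono) simp
  define h :: "'a \<times> 'a \<Rightarrow> complex"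
    where "h v = (if snd v \<in> P k \<and> (fst v - 1 \<in> P k \<or> fst v + 1 \<in> P k) then 1 else 0)" for v
  define g where "g v = h v - h (smul c v)" for v
  have h_even: "h (- v) = h v" for v
  proof -
    have "- fst v - 1 \<in> P k \<longleftrightarrow> fst v + 1 \<in> P k" "- fst v + 1 \<in> P k \<longleftrightarrow> fst v - 1 \<in> P k"
      using P_uminus[of "fst v + 1" k] P_uminus[of "fst v - 1" k] by simp_all
    then show ?thesis by (auto simp: h_def)
  qed
  have h0: "h v = 0" if "v \<notin> unimodular_pairs" for v
  proof -
    have v: "fst v \<in> P (Suc 0)" using that not_unimodular_iff by blast
    have "fst v - 1 \<notin> P (Suc 0)" "fst v + 1 \<notin> P (Suc 0)"
      using P_add_iff[OF v, of "- 1"] P_add_iff[OF v, of 1] one_notin_P1 by (simp_all add: add.commute)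
    then show ?thesis using Pk by (auto simp: h_def)
  qed
  have h_inv: "h (v + z) = h v" if "fst z \<in> P k" "snd z \<in> P k" for v z
  proof -
    have "(fst v + fst z) - 1 \<in> P k \<longleftrightarrow> fst v - 1 \<in> P k" "(fst v + fst z) + 1 \<in> P k \<longleftrightarrow> fst v + 1 \<in> P k"
      using P_add_iff[OF that(1), of "fst v - 1"] P_add_iff[OF that(1), of "fst v + 1"]
      by (simp_all add: algebra_simps)
    then show ?thesis using P_add_iff[OF that(2)] by (simp add: h_def)
  qed
  have "g (- v) = g v" for v by (simp add: g_def smul_simps h_even)
  moreover have "g v = 0" if "v \<notin> unimodular_pairs" for v
    using that h0[of v] h0[of "smul c v"] by (simp add: g_def unimodular_smul_iff)
  ultimately have g: "admissible g" unfolding admissible_def by blast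
  have g_inv: "g (v + z) = g v" if "fst z \<in> P k" "snd z \<in> P k" for v z
    using that h_inv[of z v] h_inv[of "smul c z" "smul c v"]
    by (auto simp: g_def smul_simps) (auto simp: smul_def)
  have "B j g v = 0" if "j < k" for j v
  proof -
    have "c - 1 \<in> P j" using c(1) P_antimono[of j "k - 1"] that by (simp add: subset_iff)
    then have m: "fst (smul (c - 1) v) \<in> P j" "snd (smul (c - 1) v) \<in> P j" by (auto simp: smul_def)
    have sm: "fst (smul d y) \<in> P j" "snd (smul d y) \<in> P j" if "fst y \<in> P j" "snd y \<in> P j" for d y
      using that by (auto simp: smul_def)
    \<comment> \<open>Dilation by \<open>c\<close> permutes the coset of \<open>v\<close>:
      \<open>c (v + y) = v + ((c - 1) v + c y)\<close> with \<open>c - 1\<close> in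
      \<open>P j\<close>.\<close>
    have "(\<Sum>y\<in>P j \<times> P j. h (smul c (v + y))) = (\<Sum>y\<in>P j \<times> P j. h (v + y))"
    proof (rule sum.reindex_bij_witness[of _ "\<lambda>y. smul c' (y - smul (c - 1) v)" "\<lambda>y. smul (c - 1) v + smul c y"])
      fix y assume "y \<in> P j \<times> P j"
      then have y: "fst y \<in> P j" "snd y \<in> P j" by auto
      show "smul (c - 1) v + smul c y \<in> P j \<times> P j"
        using m sm[OF y] by (auto simp: mem_Times_iff)
      show "smul c' (y - smul (c - 1) v) \<in> P j \<times> P j"
        using m y sm[of "y - smul (c - 1) v" c'] by (auto simp: mem_Times_iff)
      show "smul c' (smul (c - 1) v + smul c y - smul (c - 1) v) = y"
        using c' by (simp add: smul_simps mult.commute[of c'])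
      show "smul (c - 1) v + smul c (smul c' (y - smul (c - 1) v)) = y"
        by (simp add: smul_simps(1,2) c')
      show "h (v + (smul (c - 1) v + smul c y)) = h (smul c (v + y))"
        by (simp add: smul_simps)
    qed
    then show ?thesis by (simp add: B_def g_def sum_subtractf)
  qed
  then have TTg: "T (T g) v = \<mu>\<^sup>2 * g v - of_nat q ^ (l - 1) * S (k - 1) g v"
    if "v \<in> unimodular_pairs" for v
    using T_T_level[OF _ k(2) g g_inv _ that] k \<mu> by simp
  have S0: "S (k - 1) g v = 0" for v
    using sum_one_plus_P_mult[OF c(1,2), of "\<lambda>d. h (smul d v)"]
    by (simp add: S_def g_def sum_subtractf smul_simps mult.commute)
  have TTg': "T (T g) v = \<mu>\<^sup>2 * g v" for v
    using TTg[of v] S0[of v] admissible_zero[OF g, of v] T_not_unimodular[of v "T g"]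
    by (cases "v \<in> unimodular_pairs") auto
  define e where "e v = T g v + \<mu> * g v" for v
  have "admissible e"
    using g T_admissible[OF g] unfolding admissible_def e_def by simp
  moreover have "T e v = \<mu> * e v" for v
  proof -
    have "T e v = T (T g) v + \<mu> * T g v"
      unfolding e_def by (subst (1) T_def) (simp add: sum.distrib T_def[symmetric] T_cmult[of \<mu> g])
    then show ?thesis by (simp add: TTg' e_def power2_eq_square algebra_simps)
  qed
  \<comment> \<open>The neighbours of \<open>(1, 0)\<close> are the \<open>(t, 1)\<close>. Both 1
    and \<open>c\<close> are units, so these lie outside the support of \<open>g\<close>, whereas
    \<open>g (1, 0) = 1\<close>.\<close>
  moreover have "e (1, 0) \<noteq> 0"
  proof -
    have "det2 (1 :: 'a, 0) (0, 1) = 1" by (simp add: det2_def)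
    then have "T g (1, 0) = (\<Sum>t\<in>UNIV. g ((0, 1) + smul t (1, 0)))" by (rule T_eq)
    also have "\<dots> = 0"
      using Pk one_notin_P1 c(2) by (intro sum.neutral) (auto simp: g_def h_def smul_def)
    finally have "T g (1, 0) = 0" .
    moreover have "g (1, 0) = 1" using c(3,4) by (simp add: g_def h_def smul_def)
    moreover have "\<mu> \<noteq> 0" using \<mu> q_ge_3 by auto
    ultimately show ?thesis by (simp add: e_def)
  qed
  ultimately show ?thesis unfolding platonic_eigenvalue_iff by blast
qed

text \<open>By \<open>T_S\<close>, \<open>T (S j h) v\<close> sums \<open>h\<close> over the strip
  of points with \<open>w\<close> coordinate in \<open>1 + P j\<close>. This strip is invariant
  under the shift by \<open>z\<close>, so the two point masses forming \<open>h\<close>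
  cancel.\<close>

lemma zero_eigenvalue:
  assumes "2 \<le> l"
  shows "0 \<in> adjacency_eigenvalues (platonic_vertices :: ('a \<times> 'a) set set) platonic_adj"
proof -
  define j where "j = l - 1"
  have j: "0 < j" "j < l" using assms by (auto simp: j_def)
  define z where "z = (0 :: 'a, p ^ j)"
  have z: "fst z \<in> P j" "snd z \<in> P j" by (simp_all add: z_def power_in_P)
  define h0 :: "'a \<times> 'a \<Rightarrow> complex" where "h0 u = of_bool (u = (1, 0))" for u
  define h where "h u = h0 u - h0 (u + z)" for u
  \<comment> \<open>\<open>S j h\<close> is not even, as \<open>1 + P j\<close> does not contain -1;
    its reflection is therefore added.\<close>
  define f where "f u = S j h u + S j h (- u)" for u
  have "det2 (1 :: 'a, 0) (0, 1) = 1" by (simp add: det2_def)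
  then have uni: "(1 :: 'a, 0) \<in> unimodular_pairs" by (rule unimodularI(1))
  have h_0: "h u = 0" if "u \<notin> unimodular_pairs" for u
  proof -
    have "u + z \<notin> unimodular_pairs"
      using that unimodular_shift[of z u] z j P_antimono[of "Suc 0" j] by auto
    then show ?thesis using that uni by (auto simp: h_def h0_def)
  qed
  have TS: "T (S j h) v = 0" for v
  proof (cases "v \<in> unimodular_pairs")
    case True
    then obtain w where vw: "det2 v w = 1" using unimodular_pairs_iff by blast
    have dz: "det2 v z \<in> P j" using z by (intro det2_in_P) (simp add: mem_Times_iff)
    define G where "G c = (\<Sum>t\<in>UNIV. h0 (smul c w + smul t v))" for c
    \<comment> \<open>Adding \<open>z\<close> moves the coordinates \<open>(c, t)\<close> by
      \<open>(det2 v z, det2 z w)\<close>, and the first shift stays within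
      \<open>1 + P j\<close>.\<close>
    have "(\<Sum>t\<in>UNIV. h0 (smul (c + det2 v z) w + smul (t + det2 z w) v)) = G (c + det2 v z)" for c
      unfolding G_def
      by (rule sum.reindex_bij_witness[of _ "\<lambda>t. t - det2 z w" "\<lambda>t. t + det2 z w"]) auto
    moreover have "(\<Sum>c | c - 1 \<in> P j. G (c + det2 v z)) = (\<Sum>c | c - 1 \<in> P j. G c)"
      by (rule sum.reindex_bij_witness[of _ "\<lambda>c. c - det2 v z" "\<lambda>c. c + det2 v z"])
        (use P_add[OF _ dz] P_diff[OF _ dz] in \<open>auto simp: diff_right_commute simp flip: diff_add_eq\<close>)
    moreover have "smul (c + det2 v z) w + smul (t + det2 z w) v = smul c w + smul t v + z" for c t
      using cramer_expansion[OF vw, of z] by (simp add: smul_simps ac_simps)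
    moreover have "{c. c - 1 \<in> P j \<and> c \<notin> P (Suc 0)} = {c. c - 1 \<in> P j}"
      using one_plus_P_unit j by blast
    moreover have "T (S j h) v =
      (\<Sum>c | c - 1 \<in> P j \<and> c \<notin> P (Suc 0). \<Sum>t\<in>UNIV. h (smul c w + smul t v))"
      by (rule T_S[OF _ vw]) (rule h_0)
    ultimately show ?thesis by (simp add: h_def sum_subtractf G_def)
  qed (rule T_not_unimodular)
  have "T f v = 0" for v
  proof -
    have "T f v = T (S j h) v + T (\<lambda>u. S j h (- u)) v"
      unfolding T_def f_def by (simp add: sum.distrib)
    then show ?thesis using TS[of v] TS[of "- v"] T_uminus[of "S j h" v] by simp
  qed
  moreover have "admissible f"
  proof -
    have "S j h u = 0" if "u \<notin> unimodular_pairs" for u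
      unfolding S_def using that by (intro sum.neutral ballI h_0) (simp add: unimodular_smul_iff)
    then show ?thesis by (simp add: admissible_def f_def add.commute del: split_paired_All)
  qed
  moreover have "f (1, 0) \<noteq> 0"
  proof -
    have pj: "p ^ j \<noteq> 0" using power_nonzero j by blast
    have "S j h (1, 0) = (\<Sum>c | c - 1 \<in> P j. if c = 1 then 1 else 0)"
      unfolding S_def using pj by (intro sum.cong) (auto simp: h_def h0_def smul_def z_def)
    also have "\<dots> = 1" by simp
    finally have "S j h (1, 0) = 1" .
    moreover have "S j h (- (1, 0)) = 0"
      unfolding S_def
    proof (rule sum.neutral, rule ballI)
      fix c assume c: "c \<in> {c. c - 1 \<in> P j}"
      have "- c \<noteq> 1"
      proof
        assume "- c = 1"
        then have "c = - 1" by (metis minus_minus)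
        then have "- 2 \<in> P j" using c by simp
        then show False using P_antimono[of "Suc 0" j] j two_notin_P1 P_uminus by auto
      qed
      then show "h (smul c (- (1, 0))) = 0" by (simp add: h_def h0_def smul_def z_def)
    qed
    ultimately show ?thesis by (simp add: f_def)
  qed
  ultimately show ?thesis unfolding platonic_eigenvalue_iff by (metis mult_zero_left)
qed

text \<open>Two point masses on different lines are subtracted to get the total sum 0 that
  \<open>T_S_field\<close> asks for. Dilation by -1 makes \<open>S 0 h\<close> even.\<close>

lemma minus_one_eigenvalue:
  assumes "l = 1"
  shows "- 1 \<in> adjacency_eigenvalues (platonic_vertices :: ('a \<times> 'a) set set) platonic_adj"
proof -
  define h :: "'a \<times> 'a \<Rightarrow> complex" where "h u = (if u = (1, 0) then 1 else 0) - (if u = (0, 1) then 1 else 0)" for u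
  have "det2 (1 :: 'a, 0) (0, 1) = 1" by (simp add: det2_def)
  then have "(1 :: 'a, 0) \<in> unimodular_pairs" "(0, 1 :: 'a) \<in> unimodular_pairs"
    by (rule unimodularI)+
  then have h_0: "h u = 0" if "u \<notin> unimodular_pairs" for u using that by (auto simp: h_def)
  have "(\<Sum>u\<in>UNIV. h u) = 0" by (simp add: h_def sum_subtractf)
  have S_0: "S 0 h u = 0" if "u \<notin> unimodular_pairs" for u
    unfolding S_def using that by (intro sum.neutral ballI h_0) (simp add: unimodular_smul_iff)
  have "T (S 0 h) v = - 1 * S 0 h v" for v
    using T_S_field[OF assms h_0 \<open>(\<Sum>u\<in>UNIV. h u) = 0\<close>, of v] S_0[of v] T_not_unimodular[of v]
    by (cases "v \<in> unimodular_pairs") auto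
  moreover have "S 0 h (- u) = S 0 h u" for u
    unfolding S_def
    by (rule sum.reindex_bij_witness[of _ uminus uminus]) (simp_all add: smul_simps)
  then have "admissible (S 0 h)" using S_0 unfolding admissible_def by blast
  moreover have "S 0 h (1, 0) = (\<Sum>c\<in>(UNIV :: 'a set). if c = 1 then 1 else 0)"
    unfolding S_def P_0 by (intro sum.cong) (auto simp: h_def smul_def)
  then have "S 0 h (1, 0) \<noteq> 0" by simp
  ultimately show ?thesis unfolding platonic_eigenvalue_iff by blast
qed

section \<open>Assembling the two spectra\<close>

lemma level_powr_square:
  assumes "k \<le> l"
  shows "(complex_of_real (real q powr (real l - real k / 2)))\<^sup>2 = of_nat q ^ (2 * l - k)"
proof -
  have "(real q powr (real l - real k / 2))\<^sup>2 = real q powr (real l - real k / 2 + (real l - real k / 2))"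
    by (simp only: power2_eq_square powr_add)
  also have "real l - real k / 2 + (real l - real k / 2) = real (2 * l - k)"
    using assms by (simp add: of_nat_diff)
  also have "real q powr \<dots> = real q ^ (2 * l - k)"
    using q_ge_3 by (intro powr_realpow) simp
  finally show ?thesis by (metis of_real_of_nat_eq of_real_power)
qed

lemma level_powr_iff:
  assumes "k \<le> l"
  shows "\<mu>\<^sup>2 = of_nat q ^ (2 * l - k) \<longleftrightarrow>
    \<mu> \<in> complex_of_real ` {real q powr (real l - real k / 2), - (real q powr (real l - real k / 2))}"
  unfolding level_powr_square[OF assms, symmetric] power2_eq_iff by simp

lemma platonic_spectrum_field:
  assumes l: "l = 1"
  shows "adjacency_eigenvalues (platonic_vertices :: ('a \<times> 'a) set set) platonic_adj =
    complex_of_real ` (if q = 3 then {real q, - 1}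
      else {real q, - 1, real q powr (1 / 2), - (real q powr (1 / 2))})" (is "?E = complex_of_real ` ?A")
proof (intro subset_antisym subsetI)
  fix \<mu> assume "\<mu> \<in> ?E"
  then obtain f v where "admissible f" "f v \<noteq> 0" "\<And>v. T f v = \<mu> * f v"
    unfolding platonic_eigenvalue_iff by blast
  then show "\<mu> \<in> complex_of_real ` ?A"
  proof (cases rule: eigenvalue_cases)
    case (2 k)
    then have "k = 1" "q \<noteq> 3" using l by auto
    then show ?thesis using 2(4) level_powr_iff[of 1 \<mu>] l by auto
  qed (use l in auto)
next
  fix \<mu> assume "\<mu> \<in> complex_of_real ` ?A"
  then consider "\<mu> = of_nat q" | "\<mu> = - 1"
    | "q \<noteq> 3" "\<mu> \<in> complex_of_real ` {real q powr (1 / 2), - (real q powr (1 / 2))}"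
    by (auto split: if_splits)
  then show "\<mu> \<in> ?E"
  proof cases
    case 1
    then show ?thesis using degree_eigenvalue l by simp
  next
    case 2
    then show ?thesis using minus_one_eigenvalue[OF l] by simp
  next
    case 3
    then have "\<mu>\<^sup>2 = of_nat q ^ (2 * l - 1)" using level_powr_iff[of 1 \<mu>] l by simp
    then show ?thesis using level_eigenvalue[of 1] 3(1) l by simp
  qed
qed

lemma platonic_spectrum_nonfield:
  assumes l: "2 \<le> l"
  shows "adjacency_eigenvalues (platonic_vertices :: ('a \<times> 'a) set set) platonic_adj =
    complex_of_real ` ({real q ^ l, 0} \<union> (\<Union>k \<in> {k \<in> {1..l}. \<not> (q = 3 \<and> k = 1)}.
      {real q powr (real l - real k / 2), - (real q powr (real l - real k / 2))}))"
  (is "?E = complex_of_real ` ?A")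
proof (intro subset_antisym subsetI)
  fix \<mu> assume "\<mu> \<in> ?E"
  then obtain f v where "admissible f" "f v \<noteq> 0" "\<And>v. T f v = \<mu> * f v"
    unfolding platonic_eigenvalue_iff by blast
  then have "\<mu> = of_nat q ^ l \<or> \<mu> = 0 \<or>
    (\<exists>k. 1 \<le> k \<and> k \<le> l \<and> \<not> (q = 3 \<and> k = 1) \<and> \<mu>\<^sup>2 = of_nat q ^ (2 * l - k))"
  proof (cases rule: eigenvalue_cases)
    case 4
    \<comment> \<open>Outside the field case the value \<open>q ^ (2 l - 2)\<close> of the square is
      that of level 2.\<close>
    then show ?thesis using l by (intro disjI2 exI[of _ 2]) simp
  qed blast+
  then consider "\<mu> = complex_of_real (real q ^ l)" | "\<mu> = complex_of_real 0"
    | k where "k \<in> {k \<in> {1..l}. \<not> (q = 3 \<and> k = 1)}"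
      "\<mu> \<in> complex_of_real ` {real q powr (real l - real k / 2), - (real q powr (real l - real k / 2))}"
    using level_powr_iff[of _ \<mu>] by auto
  then show "\<mu> \<in> complex_of_real ` ?A" by cases blast+
next
  fix \<mu> assume "\<mu> \<in> complex_of_real ` ?A"
  then consider "\<mu> = of_nat q ^ l" | "\<mu> = 0"
    | k where "1 \<le> k" "k \<le> l" "\<not> (q = 3 \<and> k = 1)"
      "\<mu> \<in> complex_of_real ` {real q powr (real l - real k / 2), - (real q powr (real l - real k / 2))}"
    by fastforce
  then show "\<mu> \<in> ?E"
  proof cases
    case (3 k)
    then show ?thesis using level_eigenvalue[of k] level_powr_iff[of k \<mu>] by blast
  qed (simp_all add: degree_eigenvalue zero_eigenvalue[OF l])
qed

end

theorem theorem1p12: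
  fixes p :: "'a::comm_ring_1" and q l :: nat
  assumes "finite_valuation_ring TYPE('a)"
    and "uniformizer p"
    and "q = residue_size p"
    and "odd q"
    and "l = nilpotency_degree p"
  shows "(field_ring TYPE('a) \<longrightarrow>
      adjacency_eigenvalues (platonic_vertices :: ('a \<times> 'a) set set) platonic_adj =
        complex_of_real ` (if q = 3 then {real q, - 1}
          else {real q, - 1, real q powr (1 / 2), - (real q powr (1 / 2))}))
    \<and> (\<not> field_ring TYPE('a) \<longrightarrow>
      adjacency_eigenvalues (platonic_vertices :: ('a \<times> 'a) set set) platonic_adj =
        complex_of_real ` ({real q ^ l, 0} \<union>
          (\<Union>k \<in> {k \<in> {1..l}. \<not> (q = 3 \<and> k = 1)}.
            {real q powr (real l - real k / 2), - (real q powr (real l - real k / 2))})))"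
proof -
  interpret odd_valuation_ring p q l
    using assms by unfold_locales
  show ?thesis
  proof (intro conjI impI)
    assume "field_ring TYPE('a)"
    then have "l = 1" using field_ring_iff[OF assms(1,2)] assms(5) by simp
    then show "adjacency_eigenvalues (platonic_vertices :: ('a \<times> 'a) set set) platonic_adj =
      complex_of_real ` (if q = 3 then {real q, - 1}
        else {real q, - 1, real q powr (1 / 2), - (real q powr (1 / 2))})"
      by (rule platonic_spectrum_field)
  next
    assume "\<not> field_ring TYPE('a)"
    then have "2 \<le> l" using not_field_ring_iff[OF assms(1,2)] assms(5) by simp
    then show "adjacency_eigenvalues (platonic_vertices :: ('a \<times> 'a) set set) platonic_adj =
      complex_of_real ` ({real q ^ l, 0} \<union> (\<Union>k \<in> {k \<in> {1..l}. \<not> (q = 3 \<and> k = 1)}.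
        {real q powr (real l - real k / 2), - (real q powr (real l - real k / 2))}))"
      by (rule platonic_spectrum_nonfield)
  qed
qed

end
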